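(* Let $A$ be any Cartan matrix, and let $L(t)\in\mathbb{Z}[t]$ be the least common multiple of the Poincaré polynomials $P(A_I)$, where $A_I$ ranges over all finite type principal sub-matrices of $A$. Then the Poincaré series of the Kac-Moody Lie algebra $g(A)$ can be written as a rational function with numerator $L(t)$: there is a polynomial $Q(t)\in\mathbb{Z}[t]$ such that $$P(A)=\frac{L(t)}{Q(t)} .$$
   Context: A Cartan matrix is an $n\times n$ integer matrix $A=(a_{ij})$ with $a_{ii}=2$ for all $i$, $a_{ij}\le 0$ for $i\ne j$, and $a_{ij}=0\Rightarrow a_{ji}=0$. Its Weyl group is the Coxeter group $W(A)=\langle \sigma_1,\dots,\sigma_n \mid \sigma_i^2=1,\ (\sigma_i\sigma_j)^{m_{ij}}=1\ (i\ne j)\rangle$, where for $i\neq j$ one puts $m_{ij}=2,3,4,6,\infty$ according as $a_{ij}a_{ji}=0,1,2,3,\ge 4$ respectively (no relation if $m_{ij}=\infty$). Let $l(w)$ be the length of $w\in W(A)$ with respect to the generators. The Poincaré series of $A$ (equivalently of the Kac-Moody Lie algebra $g(A)$) is $P(A)=\sum_{w\in W(A)}t^{l(w)}\in\mathbb{Z}[[t]]$. A principal sub-matrix is $A_I=(a_{ij})_{i,j\in I}$ for $I\subset\{1,\dots,n\}$; it is again a Cartan matrix. $A$ is of finite type if it is positive definite (after symmetrization by a positive diagonal matrix), equivalently if $W(A)$ is finite; decomposable matrices are allowed. In that case $P(A)$ is a polynomial. *)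

theory Defs
  imports
    "HOL-Library.Extended_Nat"
    "HOL-Algebra.Group"
    "HOL-Computational_Algebra.Computational_Algebra"
begin

text \<open>
  A square matrix is a function together with a finite index set; the principal
  submatrix of \<open>A\<close> on \<open>I\<close> is then the same function \<open>A\<close> considered on the index
  set \<open>I\<close>.
\<close>

definition cartan_matrix :: "'i set \<Rightarrow> ('i \<Rightarrow> 'i \<Rightarrow> int) \<Rightarrow> bool" where
  "cartan_matrix S A \<longleftrightarrow>
     finite S \<and>
     (\<forall>i\<in>S. A i i = 2) \<and>
     (\<forall>i\<in>S. \<forall>j\<in>S. i \<noteq> j \<longrightarrow> A i j \<le> 0) \<and>
     (\<forall>i\<in>S. \<forall>j\<in>S. A i j = 0 \<longrightarrow> A j i = 0)"

definition coxeter_exponent :: "('i \<Rightarrow> 'i \<Rightarrow> int) \<Rightarrow> 'i \<Rightarrow> 'i \<Rightarrow> enat" where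
  "coxeter_exponent A i j =
     (if A i j * A j i = 0 then 2
      else if A i j * A j i = 1 then 3
      else if A i j * A j i = 2 then 4
      else if A i j * A j i = 3 then 6
      else \<infinity>)"

text \<open>
  Two words in the generators are related iff they represent the same element of the
  Weyl group. As every generator is its own inverse, formal inverses of
  generators are not needed, and the group presentation is a monoid presentation.
\<close>

inductive weyl_eq :: "'i set \<Rightarrow> ('i \<Rightarrow> 'i \<Rightarrow> int) \<Rightarrow> 'i list \<Rightarrow> 'i list \<Rightarrow> bool"
  for S :: "'i set" and A :: "'i \<Rightarrow> 'i \<Rightarrow> int" where
  refl: "u \<in> lists S \<Longrightarrow> weyl_eq S A u u"
| sym: "weyl_eq S A u v \<Longrightarrow> weyl_eq S A v u"
| trans: "weyl_eq S A u v \<Longrightarrow> weyl_eq S A v w \<Longrightarrow> weyl_eq S A u w"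
| mult: "weyl_eq S A u v \<Longrightarrow> weyl_eq S A u' v' \<Longrightarrow> weyl_eq S A (u @ u') (v @ v')"
| square: "i \<in> S \<Longrightarrow> weyl_eq S A [i, i] []"
| braid: "i \<in> S \<Longrightarrow> j \<in> S \<Longrightarrow> i \<noteq> j \<Longrightarrow> coxeter_exponent A i j = enat m \<Longrightarrow>
    weyl_eq S A (concat (replicate m [i, j])) []"

definition weyl_rel :: "'i set \<Rightarrow> ('i \<Rightarrow> 'i \<Rightarrow> int) \<Rightarrow> ('i list \<times> 'i list) set" where
  "weyl_rel S A = {(u, v). weyl_eq S A u v}"

definition weyl_group :: "'i set \<Rightarrow> ('i \<Rightarrow> 'i \<Rightarrow> int) \<Rightarrow> 'i list set monoid" where
  "weyl_group S A =
     \<lparr>carrier = lists S // weyl_rel S A,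
      monoid.mult = (\<lambda>X Y. \<Union>u\<in>X. \<Union>v\<in>Y. weyl_rel S A `` {u @ v}),
      monoid.one = weyl_rel S A `` {[]}\<rparr>"

text \<open>
  An element of the group is the set of all words representing it, so its length is
  the least length of one of its members.
\<close>

definition weyl_length :: "'i list set \<Rightarrow> nat" where
  "weyl_length w = (LEAST k. \<exists>u\<in>w. length u = k)"

definition poincare_series :: "'i set \<Rightarrow> ('i \<Rightarrow> 'i \<Rightarrow> int) \<Rightarrow> int fps" where
  "poincare_series S A =
     Abs_fps (\<lambda>k. int (card {w \<in> carrier (weyl_group S A). weyl_length w = k}))"

text \<open>Only meaningful if the Weyl group is finite; see \<open>fps_of_poly_poincare_poly\<close> below.\<close>

definition poincare_poly :: "'i set \<Rightarrow> ('i \<Rightarrow> 'i \<Rightarrow> int) \<Rightarrow> int poly" where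
  "poincare_poly S A = (\<Sum>w\<in>carrier (weyl_group S A). monom 1 (weyl_length w))"

definition finite_type :: "'i set \<Rightarrow> ('i \<Rightarrow> 'i \<Rightarrow> int) \<Rightarrow> bool" where
  "finite_type I A \<longleftrightarrow>
     (\<exists>d :: 'i \<Rightarrow> real.
        (\<forall>i\<in>I. d i > 0) \<and>
        (\<forall>i\<in>I. \<forall>j\<in>I. d i * of_int (A i j) = d j * of_int (A j i)) \<and>
        (\<forall>x :: 'i \<Rightarrow> real. (\<exists>i\<in>I. x i \<noteq> 0) \<longrightarrow>
           (\<Sum>i\<in>I. \<Sum>j\<in>I. x i * (d i * of_int (A i j)) * x j) > 0))"

lemma weyl_eq_lists: "weyl_eq S A u v \<Longrightarrow> u \<in> lists S \<and> v \<in> lists S"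
  by (induction rule: weyl_eq.induct) (auto split: if_splits)

lemma equiv_weyl_rel: "equiv (lists S) (weyl_rel S A)"
  unfolding weyl_rel_def
  by (rule equivI)
     (auto intro!: refl_onI symI transI dest: weyl_eq_lists
           intro: weyl_eq.refl weyl_eq.sym weyl_eq.trans simp del: in_lists_conv_set)

lemma weyl_mult_class:
  assumes "u \<in> lists S" "v \<in> lists S"
  shows "weyl_rel S A `` {u} \<otimes>\<^bsub>weyl_group S A\<^esub> weyl_rel S A `` {v} = weyl_rel S A `` {u @ v}"
proof -
  have "congruent2 (weyl_rel S A) (weyl_rel S A) (\<lambda>u v. weyl_rel S A `` {u @ v})"
    by (rule congruent2I', rule equiv_class_eq[OF equiv_weyl_rel])
       (auto simp: weyl_rel_def intro: weyl_eq.mult)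
  from UN_equiv_class2[OF equiv_weyl_rel equiv_weyl_rel this assms] show ?thesis
    by (simp add: weyl_group_def)
qed

lemma weyl_eq_rev_append: "u \<in> lists S \<Longrightarrow> weyl_eq S A (rev u @ u) []"
proof (induction u)
  case Nil
  then show ?case by (simp add: weyl_eq.refl)
next
  case (Cons i u)
  then have u: "u \<in> lists S" "i \<in> S" by auto
  then have "weyl_eq S A (rev u @ [i, i] @ u) (rev u @ [] @ u)"
    by (intro weyl_eq.mult weyl_eq.refl weyl_eq.square) auto
  with Cons.IH u show ?case by (auto intro: weyl_eq.trans)
qed

lemma group_weyl_group: "group (weyl_group S A)"
proof (rule groupI)
  note carrier = weyl_group_def quotient_def
  have cls: "\<exists>u\<in>lists S. X = weyl_rel S A `` {u}" if "X \<in> carrier (weyl_group S A)" for X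
    using that by (auto simp: carrier)
  have in_carrier: "weyl_rel S A `` {u} \<in> carrier (weyl_group S A)" if "u \<in> lists S" for u
    using that by (auto simp: carrier)
  have one: "\<one>\<^bsub>weyl_group S A\<^esub> = weyl_rel S A `` {[]}"
    by (simp add: weyl_group_def)
  show "\<one>\<^bsub>weyl_group S A\<^esub> \<in> carrier (weyl_group S A)"
    unfolding one by (rule in_carrier) simp
  fix X assume "X \<in> carrier (weyl_group S A)"
  then obtain u where u: "u \<in> lists S" "X = weyl_rel S A `` {u}" using cls by blast
  show "\<one>\<^bsub>weyl_group S A\<^esub> \<otimes>\<^bsub>weyl_group S A\<^esub> X = X"
    unfolding one u using u by (subst weyl_mult_class) auto
  have "weyl_rel S A `` {rev u} \<otimes>\<^bsub>weyl_group S A\<^esub> X = \<one>\<^bsub>weyl_group S A\<^esub>"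
    unfolding one u(2) using u(1) equiv_class_eq[OF equiv_weyl_rel, of "rev u @ u" "[]" S A]
    by (subst weyl_mult_class) (auto simp: weyl_rel_def weyl_eq_rev_append)
  then show "\<exists>Y\<in>carrier (weyl_group S A). Y \<otimes>\<^bsub>weyl_group S A\<^esub> X = \<one>\<^bsub>weyl_group S A\<^esub>"
    by (rule bexI) (rule in_carrier, use u(1) in auto)
  fix Y assume "Y \<in> carrier (weyl_group S A)"
  then obtain v where v: "v \<in> lists S" "Y = weyl_rel S A `` {v}" using cls by blast
  show "X \<otimes>\<^bsub>weyl_group S A\<^esub> Y \<in> carrier (weyl_group S A)"
    unfolding u v weyl_mult_class[OF u(1) v(1)] using u(1) v(1) by (intro in_carrier) auto
  fix Z assume "Z \<in> carrier (weyl_group S A)"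
  then obtain w where w: "w \<in> lists S" "Z = weyl_rel S A `` {w}" using cls by blast
  have "u @ v \<in> lists S" "v @ w \<in> lists S" using u(1) v(1) w(1) by auto
  then show "X \<otimes>\<^bsub>weyl_group S A\<^esub> Y \<otimes>\<^bsub>weyl_group S A\<^esub> Z =
        X \<otimes>\<^bsub>weyl_group S A\<^esub> (Y \<otimes>\<^bsub>weyl_group S A\<^esub> Z)"
    unfolding u(2) v(2) w(2) using u(1) v(1) w(1) by (simp add: weyl_mult_class del: in_lists_conv_set)
qed

lemma fps_of_poly_poincare_poly:
  assumes "finite (carrier (weyl_group S A))"
  shows "fps_of_poly (poincare_poly S A) = poincare_series S A"
  by (rule fps_ext)
     (simp add: poincare_poly_def poincare_series_def coeff_sum coeff_monom
        sum.If_cases[OF assms] Int_def eq_commute)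

end

theory Submission
  imports Defs
begin

text \<open>
  The Poincare series is computed by induction on the size of \<open>S\<close>. If the Weyl group is finite,
  then the matrix is of finite type and \<open>P(A)\<close> itself divides \<open>L\<close>. If it is
  infinite, every \<open>P(A\<^sub>I)\<close> with \<open>I\<close> a proper subset has, inductively, the form \<open>L / Q\<^sub>I\<close>, and an
  identity of Bourbaki and Steinberg expresses \<open>1 / P(A)\<close> through these quotients.

  The identity: let \<open>W\<^sup>I\<close> be the set of \<open>w\<close> with \<open>l(ws) > l(w)\<close> for all \<open>s \<in> I\<close>. Each \<open>w\<close> factors uniquely
  as \<open>xy\<close> with \<open>x \<in> W\<^sup>I\<close> and \<open>y \<in> W\<^sub>I\<close>, and lengths add, so \<open>P(A) = N\<^sub>I \<cdot> P(A\<^sub>I)\<close>, where \<open>N\<^sub>I\<close> is the length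
  series of \<open>W\<^sup>I\<close> (\<open>length_series_factor\<close>). In the sum of \<open>(-1)\<^sup>|\<^sup>I\<^sup>| N\<^sub>I\<close> over all \<open>I \<subseteq> S\<close> an
  element \<open>w\<close> is counted with the alternating sum over all subsets of its ascent set, which
  vanishes unless \<open>w\<close> has no ascent at all. An element without ascents is a longest element, and
  it bounds all lengths, so for infinite \<open>W\<close> the sum is zero (\<open>alternating_sum_min_reps\<close>).
  Multiplying by \<open>L\<close> and using \<open>N\<^sub>S = 1\<close> and \<open>N\<^sub>I L = N\<^sub>I P(A\<^sub>I) Q\<^sub>I = P(A) Q\<^sub>I\<close> gives
  \<open>L = P(A) \<cdot> Q\<close> with \<open>Q\<close> an alternating sum of the \<open>Q\<^sub>I\<close>.

  Everything about the group comes from its action on the root lattice, where \<open>\<sigma>\<^sub>i\<close> sends the simple root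
  \<open>\<alpha>\<^sub>j\<close> to \<open>\<alpha>\<^sub>j - A i j \<cdot> \<alpha>\<^sub>i\<close>. The central fact (\<open>reduced_snoc_nonneg\<close>) is that \<open>l(ws) > l(w)\<close> implies that
  \<open>w \<alpha>\<^sub>s\<close> has nonnegative coordinates; it is reduced to an explicit calculation in rank two, where
  the definition of the Coxeter exponents enters. It shows that the action is faithful and that the length
  of \<open>W\<^sub>I\<close> is the restriction of that of \<open>W\<close>, and it turns the comparison of \<open>l(ws)\<close> with \<open>l(w)\<close>
  into a sign condition that is compatible with linear combinations; the factorization
  and the property of the longest element are read off from such signs.

  Finally, \<open>W\<close> is finite exactly for finite type. A positive definite invariant form leaves only finitely
  many possibilities for the integers \<open>\<langle>\<alpha>\<^sub>j\<^sup>v, w \<alpha>\<^sub>i\<rangle>\<close>, and these determine \<open>w\<close>; conversely, averaging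
  the standard scalar product over a finite \<open>W\<close> gives an invariant form, and the reflections
  being isometries forces its Gram matrix to be a symmetrization of \<open>A\<close>.
\<close>

section \<open>Words and reduced words\<close>

text \<open>
  The alternating word of length \<open>k\<close> in two letters. Its last letter is always \<open>t\<close>, and it grows at the
  front: the letter that acts first on a vector stays fixed when the word is extended.
\<close>

fun alternating :: "'i \<Rightarrow> 'i \<Rightarrow> nat \<Rightarrow> 'i list" where
  "alternating s t 0 = []"
| "alternating s t (Suc k) = (if even k then t else s) # alternating s t k"

lemma length_alternating [simp]: "length (alternating s t k) = k"
  by (induction k) auto

lemma alternating_in_lists: "s \<in> I \<Longrightarrow> t \<in> I \<Longrightarrow> alternating s t k \<in> lists I"
  by (induction k) auto

lemma alternating_double: "alternating s t (2 * m) = concat (replicate m [s, t])"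
  by (induction m) auto

lemma alternating_split:
  "k \<le> l \<Longrightarrow> \<exists>x. alternating s t l = x @ alternating s t k \<and> length x = l - k \<and> set x \<subseteq> {s, t}"
proof (induction l rule: dec_induct)
  case base
  then show ?case by auto
next
  case (step l)
  then obtain x where x: "alternating s t l = x @ alternating s t k" "length x = l - k" "set x \<subseteq> {s, t}"
    by blast
  show ?case
    by (rule exI[of _ "(if even l then t else s) # x"]) (use x step in auto)
qed

lemma weyl_eq_append_cancel:
  assumes "u \<in> lists I" "w \<in> lists I" "i \<in> I"
  shows "weyl_eq I A (u @ [i, i] @ w) (u @ w)"
  using weyl_eq.mult[OF weyl_eq.refl[OF assms(1)] weyl_eq.mult[OF weyl_eq.square[OF assms(3)] weyl_eq.refl[OF assms(2)]]]
  by simp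

lemma weyl_eq_even_length: "weyl_eq I A u v \<Longrightarrow> even (length u) \<longleftrightarrow> even (length v)"
  by (induction rule: weyl_eq.induct) (auto simp: length_concat sum_list_replicate)

lemma weyl_eq_append_left:
  "weyl_eq I A v w \<Longrightarrow> u \<in> lists I \<Longrightarrow> weyl_eq I A (u @ v) (u @ w)"
  by (intro weyl_eq.mult weyl_eq.refl)

lemma weyl_eq_append_right:
  "weyl_eq I A v w \<Longrightarrow> u \<in> lists I \<Longrightarrow> weyl_eq I A (v @ u) (w @ u)"
  by (intro weyl_eq.mult weyl_eq.refl)

text \<open>
  The braid relation in its positive form. Prepending \<open>alternating j i k\<close> to the relator
  \<open>(ij)\<^sup>m\<close> cancels its first \<open>k\<close> letters; take \<open>k = m\<close>.
\<close>

lemma weyl_eq_alternating_swap: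
  assumes ij: "i \<in> I" "j \<in> I" "i \<noteq> j" and m: "coxeter_exponent A i j = enat m"
  shows "weyl_eq I A (alternating i j m) (alternating j i m)"
proof -
  have cancel: "weyl_eq I A (alternating j i k @ alternating i j (2 * m)) (alternating i j (2 * m - k))"
    if "k \<le> 2 * m" for k
    using that
  proof (induction k)
    case 0
    show ?case using ij by (simp add: weyl_eq.refl alternating_in_lists del: in_lists_conv_set)
  next
    case (Suc k)
    define c where "c = (if even k then i else j)"
    have c: "c \<in> I" using ij by (auto simp: c_def)
    have eq: "2 * m - k = Suc (2 * m - Suc k)" using Suc.prems by simp
    have par: "even (2 * m - Suc k) \<longleftrightarrow> odd k" using Suc.prems by auto
    have "alternating i j (2 * m - k) = c # alternating i j (2 * m - Suc k)"
      unfolding eq using par by (simp add: c_def)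
    then have "weyl_eq I A ([c] @ (alternating j i k @ alternating i j (2 * m)))
        ([] @ [c, c] @ alternating i j (2 * m - Suc k))"
      using weyl_eq_append_left[OF Suc.IH, of "[c]"] Suc.prems c by auto
    moreover have "weyl_eq I A ([] @ [c, c] @ alternating i j (2 * m - Suc k)) ([] @ alternating i j (2 * m - Suc k))"
      using c ij by (intro weyl_eq_append_cancel alternating_in_lists) auto
    ultimately show ?case
      using weyl_eq.trans by (fastforce simp: c_def)
  qed
  have "weyl_eq I A (alternating j i m @ alternating i j (2 * m)) (alternating j i m @ [])"
    unfolding alternating_double using ij m
    by (intro weyl_eq_append_left weyl_eq.braid alternating_in_lists)
  with cancel[of m] show ?thesis
    by (auto intro: weyl_eq.trans weyl_eq.sym)
qed

definition reduced :: "'i set \<Rightarrow> ('i \<Rightarrow> 'i \<Rightarrow> int) \<Rightarrow> 'i list \<Rightarrow> bool" where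
  "reduced I A u \<longleftrightarrow> u \<in> lists I \<and> (\<forall>v. weyl_eq I A u v \<longrightarrow> length u \<le> length v)"

lemma reduced_le: "reduced I A u \<Longrightarrow> weyl_eq I A u v \<Longrightarrow> length u \<le> length v"
  by (simp add: reduced_def)

lemma reduced_weyl_eq: "reduced I A u \<Longrightarrow> weyl_eq I A u v \<Longrightarrow> length v = length u \<Longrightarrow> reduced I A v"
  unfolding reduced_def using weyl_eq_lists by (metis weyl_eq.trans)

lemma reduced_appendD1:
  assumes "reduced I A (u @ w)" shows "reduced I A u"
  unfolding reduced_def
proof (intro conjI allI impI)
  show "u \<in> lists I" using assms by (auto simp: reduced_def)
  fix v assume "weyl_eq I A u v"
  then have "weyl_eq I A (u @ w) (v @ w)"
    using assms by (intro weyl_eq_append_right) (auto simp: reduced_def)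
  then show "length u \<le> length v" using assms by (fastforce simp: reduced_def)
qed

lemma reduced_exists:
  assumes "u \<in> lists I" shows "\<exists>v. weyl_eq I A u v \<and> reduced I A v"
proof -
  define v where "v = (ARG_MIN length v. weyl_eq I A u v)"
  have "weyl_eq I A u u" using assms by (rule weyl_eq.refl)
  from arg_min_nat_lemma[of "weyl_eq I A u", OF this, of length]
  have "weyl_eq I A u v" "\<And>w. weyl_eq I A u w \<Longrightarrow> length v \<le> length w" by (auto simp: v_def)
  then show ?thesis unfolding reduced_def
    using weyl_eq_lists weyl_eq.trans by metis
qed

text \<open>
  All relators have even length, so multiplication by a generator changes the length by exactly one.
\<close>

lemma not_reduced_snoc:
  assumes u: "reduced I A u" and s: "s \<in> I" and nr: "\<not> reduced I A (u @ [s])"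
  shows "\<exists>v. weyl_eq I A u (v @ [s]) \<and> reduced I A (v @ [s]) \<and> Suc (length v) = length u"
proof -
  have us: "u @ [s] \<in> lists I" using u s by (auto simp: reduced_def)
  with nr obtain v where v: "weyl_eq I A (u @ [s]) v" "length v < length (u @ [s])"
    by (auto simp: reduced_def not_le)
  have "even (length v) \<longleftrightarrow> even (length (u @ [s]))" using weyl_eq_even_length v(1) by blast
  then have less: "length v < length u" using v(2) by (cases "length v = length u") auto
  have "weyl_eq I A (u @ [s, s] @ []) (u @ [])" 
    using u s by (intro weyl_eq_append_cancel) (auto simp: reduced_def)
  moreover have "weyl_eq I A ((u @ [s]) @ [s]) (v @ [s])" using s by (intro weyl_eq_append_right v) auto
  ultimately have eq: "weyl_eq I A u (v @ [s])" by (auto intro: weyl_eq.sym weyl_eq.trans)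
  then have "length u \<le> length (v @ [s])" using u by (auto simp: reduced_def)
  then have "Suc (length v) = length u" using less by auto
  with eq u show ?thesis using reduced_weyl_eq[OF u eq] by auto
qed

section \<open>The action on the root lattice\<close>

text \<open>
  Lattice vectors are functions on all indices, of which only the coordinates in \<open>S\<close> are paired with coroots.
  The lattice of \<open>S\<close> serves for all subsets \<open>I\<close> at once: words in \<open>I\<close> act on it as well,
  which makes the groups of the principal submatrices comparable.
\<close>

locale cartan =
  fixes S :: "'i set" and A :: "'i \<Rightarrow> 'i \<Rightarrow> int"
  assumes cartan_matrix: "cartan_matrix S A"
begin

lemma finite_S [simp]: "finite S"
  and diag: "i \<in> S \<Longrightarrow> A i i = 2"
  and off_diag: "i \<in> S \<Longrightarrow> j \<in> S \<Longrightarrow> i \<noteq> j \<Longrightarrow> A i j \<le> 0"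
  and zero_pattern: "i \<in> S \<Longrightarrow> j \<in> S \<Longrightarrow> A i j = 0 \<Longrightarrow> A j i = 0"
  using cartan_matrix by (auto simp: cartan_matrix_def)

definition coroot :: "'i \<Rightarrow> ('i \<Rightarrow> int) \<Rightarrow> int" where
  "coroot i v = (\<Sum>j\<in>S. A i j * v j)"

definition reflect :: "'i \<Rightarrow> ('i \<Rightarrow> int) \<Rightarrow> 'i \<Rightarrow> int" where
  "reflect i v = v(i := v i - coroot i v)"

definition act :: "'i list \<Rightarrow> ('i \<Rightarrow> int) \<Rightarrow> 'i \<Rightarrow> int" where
  "act u = foldr reflect u"

definition simple_root :: "'i \<Rightarrow> 'i \<Rightarrow> int" where
  "simple_root i = (\<lambda>k. if k = i then 1 else 0)"

lemma act_Nil [simp]: "act [] = id" and act_Cons: "act (i # u) = reflect i \<circ> act u"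
  and act_append: "act (u @ w) = act u \<circ> act w"
  by (auto simp: act_def)

lemma coroot_update: "i \<in> S \<Longrightarrow> coroot k (v(i := v i + c)) = coroot k v + A k i * c"
proof -
  assume i: "i \<in> S"
  have "coroot k (v(i := v i + c)) = (\<Sum>j\<in>S. A k j * v j + (if j = i then A k i * c else 0))"
    unfolding coroot_def by (rule sum.cong) (auto simp: algebra_simps)
  then show ?thesis using i by (simp add: sum.distrib coroot_def)
qed

lemma coroot_simple_root: "j \<in> S \<Longrightarrow> coroot i (simple_root j) = A i j"
  by (simp add: coroot_def simple_root_def if_distrib cong: if_cong)

lemma reflect_simple_root: "i \<in> S \<Longrightarrow> reflect i (simple_root i) = (\<lambda>k. - simple_root i k)"
  by (simp add: reflect_def coroot_simple_root diag) (auto simp: simple_root_def fun_eq_iff)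

lemma reflect_reflect: "i \<in> S \<Longrightarrow> reflect i (reflect i v) = v"
  using coroot_update[of i i v "- coroot i v"] by (auto simp: reflect_def diag)

lemma reflect_shift:
  assumes "i \<in> S" "j \<in> S" "i \<noteq> j"
  shows "reflect i (v(i := v i + a, j := v j + b)) = v(i := v i + (- a - A i j * b - coroot i v), j := v j + b)"
proof -
  have "coroot i (v(i := v i + a, j := v j + b)) = coroot i v + 2 * a + A i j * b"
    using coroot_update[of j i "v(i := v i + a)" b] coroot_update[of i i v a] assms diag
    by simp
  with assms show ?thesis by (auto simp: reflect_def)
qed

lemma act_pair_shift:
  assumes "i \<in> S" "j \<in> S" "i \<noteq> j"
  shows "act [i, j] (v(i := v i + a, j := v j + b)) =
    v(i := v i + ((A i j * A j i - 1) * a + A i j * b + A i j * coroot j v - coroot i v),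
      j := v j + (- b - A j i * a - coroot j v))"
proof -
  have "reflect j (v(i := v i + a, j := v j + b)) = v(i := v i + a, j := v j + (- b - A j i * a - coroot j v))"
    using reflect_shift[of j i v b a] assms by (simp add: fun_upd_twist)
  then show ?thesis
    using reflect_shift[of i j v a "- b - A j i * a - coroot j v"] assms
    by (simp add: act_Cons) (simp add: algebra_simps)
qed

text \<open>
  The product of two reflections has order \<open>2, 3, 4, 6\<close> on the whole lattice, not just on the span of the two
  roots, when \<open>A i j * A j i\<close> is \<open>0, 1, 2, 3\<close>.
\<close>

lemma act_braid:
  assumes ij: "i \<in> S" "j \<in> S" "i \<noteq> j" and m: "coxeter_exponent A i j = enat m"
  shows "act (concat (replicate m [i, j])) v = v"
proof -
  define st where "st = (\<lambda>(a, b). v(i := v i + a, j := v j + b))"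
  define p q X Y where pq: "p = A i j" "q = A j i" and XY: "X = coroot i v" "Y = coroot j v"
  define T where "T = (\<lambda>(a, b). ((p * q - 1) * a + p * b + p * Y - X, - b - q * a - Y))"
  have step: "act [i, j] (st z) = st (T z)" for z
    using act_pair_shift[OF ij] by (cases z) (simp add: st_def T_def pq XY)
  have iter: "act (concat (replicate k [i, j])) (st z) = st ((T ^^ k) z)" for k z
  proof (induction k arbitrary: z)
    case (Suc k)
    have "act (concat (replicate (Suc k) [i, j])) = act [i, j] \<circ> act (concat (replicate k [i, j]))"
      by (simp flip: act_append)
    then show ?case using Suc[of z] step by simp
  qed simp
  \<comment> \<open>The orbit of \<open>v\<close> stays in \<open>v + \<int> \<alpha>\<^sub>i + \<int> \<alpha>\<^sub>j\<close>, where \<open>\<sigma>\<^sub>i \<sigma>\<^sub>j\<close> is the affine map \<open>T\<close>.\<close>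
  have "(T ^^ m) (0, 0) = (0, 0)"
  proof -
    consider "p * q = 0" "m = 2" | "p * q = 1" "m = 3" | "p * q = 2" "m = 4" | "p * q = 3" "m = 6"
      using m by (auto simp: coxeter_exponent_def pq numeral_eq_enat split: if_splits)
    then show ?thesis
    proof cases
      case 1
      then have "p = 0" "q = 0" using zero_pattern ij by (auto simp: pq)
      with 1 show ?thesis by (simp add: T_def eval_nat_numeral)
    next
      case 2
      then have [simp]: "p * (q * z) = z" for z by (metis mult.assoc mult_1)
      from 2 show ?thesis by (simp add: T_def eval_nat_numeral) (simp add: algebra_simps)
    next
      case 3
      then have [simp]: "p * (q * z) = 2 * z" for z by (metis mult.assoc)
      from 3 show ?thesis by (simp add: T_def eval_nat_numeral) (simp add: algebra_simps)
    next
      case 4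
      then have [simp]: "p * (q * z) = 3 * z" for z by (metis mult.assoc)
      from 4 show ?thesis by (simp add: T_def eval_nat_numeral) (simp add: algebra_simps)
    qed
  qed
  moreover have "v = st (0, 0)" by (simp add: st_def)
  ultimately show ?thesis using iter by metis
qed

lemma act_weyl_eq: "weyl_eq I A u v \<Longrightarrow> I \<subseteq> S \<Longrightarrow> act u = act v"
proof (induction rule: weyl_eq.induct)
  case (square i)
  then show ?case by (auto simp: act_Cons reflect_reflect fun_eq_iff)
next
  case (braid i j m)
  show ?case by (rule ext, subst act_braid) (use braid in auto)
qed (auto simp: act_append)

text \<open>
  The coordinates of \<open>alternating s t k\<close> applied to \<open>\<alpha>\<^sub>s\<close> with respect to \<open>\<alpha>\<^sub>s\<close> and \<open>\<alpha>\<^sub>t\<close>, for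
  \<open>p = - A s t\<close> and \<open>q = - A t s\<close>.
\<close>

fun string_coeffs :: "int \<Rightarrow> int \<Rightarrow> nat \<Rightarrow> int \<times> int" where
  "string_coeffs p q 0 = (1, 0)"
| "string_coeffs p q (Suc k) = (let (c, d) = string_coeffs p q k in
     if even k then (c, q * c - d) else (p * d - c, d))"

lemma act_alternating_simple_root:
  assumes "s \<in> S" "t \<in> S" "s \<noteq> t"
  shows "act (alternating s t k) (simple_root s) =
    (let (c, d) = string_coeffs (- A s t) (- A t s) k in (\<lambda>x. c * simple_root s x + d * simple_root t x))"
proof (induction k)
  case 0
  show ?case by simp
next
  case (Suc k)
  obtain c d where cd: "string_coeffs (- A s t) (- A t s) k = (c, d)" by force
  have co: "coroot i (\<lambda>x. c * simple_root s x + d * simple_root t x) = A i s * c + A i t * d" for i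
    using coroot_simple_root[of s i] coroot_simple_root[of t i] assms
    by (simp add: coroot_def distrib_left sum.distrib mult.left_commute[of _ c] mult.left_commute[of _ d]
      flip: sum_distrib_left)
  show ?case
  proof (rule ext)
    fix x
    have "act (alternating s t k) (simple_root s) = (\<lambda>x. c * simple_root s x + d * simple_root t x)"
      using Suc cd by simp
    then show "act (alternating s t (Suc k)) (simple_root s) x = (let (c, d) = string_coeffs (- A s t) (- A t s) (Suc k) in
        (\<lambda>x. c * simple_root s x + d * simple_root t x)) x"
      using cd assms diag[of s] diag[of t] by (simp add: act_Cons reflect_def co) (simp add: simple_root_def)
  qed
qed

text \<open>
  A reflection replaces \<open>c\<close> by \<open>p d - c\<close> or \<open>d\<close> by \<open>q c - d\<close>, so the last conjunct says that the most recent
  one did not decrease its coordinate. The condition \<open>p q \<ge> 4\<close> passes this on to the next reflection.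
\<close>

lemma string_coeffs_infinite:
  assumes "p \<ge> 0" "q \<ge> 0" "p * q \<ge> 4"
  shows "(case string_coeffs p q k of (c, d) \<Rightarrow> c \<ge> 0 \<and> d \<ge> 0 \<and>
     (if even k then 2 * c \<ge> p * d else 2 * d \<ge> q * c))"
proof (induction k)
  case 0
  show ?case by simp
next
  case (Suc k)
  obtain c d where cd: "string_coeffs p q k = (c, d)" by force
  show ?case
  proof (cases "even k")
    case True
    with Suc cd have h: "c \<ge> 0" "d \<ge> 0" "2 * c \<ge> p * d" by auto
    have "q * (2 * c) \<ge> q * (p * d)" using h assms by (intro mult_left_mono)
    moreover have "q * (p * d) = (p * q) * d" "(p * q) * d \<ge> 4 * d" using h assms by (auto intro: mult_right_mono)
    ultimately have "q * c \<ge> 2 * d" by linarith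
    then show ?thesis using True cd h by (simp add: mult.commute)
  next
    case False
    with Suc cd have h: "c \<ge> 0" "d \<ge> 0" "2 * d \<ge> q * c" by auto
    have "p * (2 * d) \<ge> p * (q * c)" using h assms by (intro mult_left_mono)
    moreover have "p * (q * c) = (p * q) * c" "(p * q) * c \<ge> 4 * c" using h assms by (auto intro: mult_right_mono)
    ultimately have "p * d \<ge> 2 * c" by linarith
    then show ?thesis using False cd h by (simp add: mult.commute)
  qed
qed

text \<open>
  Below the Coxeter exponent the coordinates are those of positive roots of rank two; for types
  \<open>A1 \<times> A1\<close>, \<open>A2\<close>, \<open>B2\<close> and \<open>G2\<close> there are finitely many to inspect.
\<close>

lemma string_coeffs_nonneg:
  assumes st: "s \<in> S" "t \<in> S" "s \<noteq> t" and k: "enat k < coxeter_exponent A s t"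
    and cd: "string_coeffs (- A s t) (- A t s) k = (c, d)"
  shows "c \<ge> 0 \<and> d \<ge> 0"
proof -
  define p q where pq: "p = - A s t" "q = - A t s"
  have nn: "p \<ge> 0" "q \<ge> 0" using off_diag st by (auto simp: pq)
  have prod: "A s t * A t s = p * q" by (simp add: pq)
  have "p * q \<ge> 0" using nn by simp
  then consider "p * q = 0" "k < 2" | "p * q = 1" "k < 3" | "p * q = 2" "k < 4" | "p * q = 3" "k < 6" | "p * q \<ge> 4"
    using k unfolding coxeter_exponent_def prod numeral_eq_enat
    by (cases "p * q = 0"; cases "p * q = 1"; cases "p * q = 2"; cases "p * q = 3") auto
  then show ?thesis
  proof cases
    case 1
    then have "p = 0" "q = 0" using zero_pattern st by (auto simp: pq)
    then show ?thesis using cd 1 by (auto simp: pq less_Suc_eq numeral_eq_Suc)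
  next
    case 2
    then have [simp]: "p * (q * z) = z" for z by (metis mult.assoc mult_1)
    show ?thesis using cd 2 nn unfolding pq[symmetric]
      by (auto simp: less_Suc_eq eval_nat_numeral right_diff_distrib)
  next
    case 3
    then have [simp]: "p * (q * z) = 2 * z" for z by (metis mult.assoc)
    show ?thesis using cd 3 nn unfolding pq[symmetric]
      by (auto simp: less_Suc_eq eval_nat_numeral right_diff_distrib)
  next
    case 4
    then have [simp]: "p * (q * z) = 3 * z" for z by (metis mult.assoc)
    have six: "(6 :: nat) = Suc (Suc (Suc (Suc (Suc (Suc 0)))))" by simp
    show ?thesis using cd 4 nn unfolding pq[symmetric] six
      by (auto simp: less_Suc_eq right_diff_distrib)
  next
    case 5
    then show ?thesis using string_coeffs_infinite[of p q k] nn cd by (simp add: pq)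
  qed
qed

section \<open>Ascents give positive roots\<close>

lemma coroot_linear:
  "coroot i (\<lambda>x. a * v x + b * w x) = a * coroot i v + b * coroot i w"
  by (simp add: coroot_def distrib_left sum.distrib mult.left_commute[of _ a] mult.left_commute[of _ b]
      flip: sum_distrib_left)

lemma act_linear:
  "act u (\<lambda>x. a * v x + b * w x) = (\<lambda>x. a * act u v x + b * act u w x)"
proof (induction u)
  case (Cons i u)
  then show ?case by (auto simp: act_Cons reflect_def coroot_linear algebra_simps)
qed simp

text \<open>
  Let \<open>t\<close> be the last letter of \<open>u\<close>, and split \<open>u\<close>, up to equality in the group, as \<open>y\<close> times an alternating
  word in \<open>s, t\<close> that is as long as possible, with lengths adding. Maximality makes \<open>ys\<close> and \<open>yt\<close>
  reduced, so \<open>y \<alpha>\<^sub>s\<close> and \<open>y \<alpha>\<^sub>t\<close> are nonnegative by induction. The alternating word is shorter than the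
  braid relation, because otherwise the relation would produce an expression ending in \<open>s\<close>. Hence it sends
  \<open>\<alpha>\<^sub>s\<close> to a nonnegative combination of \<open>\<alpha>\<^sub>s\<close> and \<open>\<alpha>\<^sub>t\<close>.
\<close>

lemma reduced_snoc_nonneg:
  assumes I: "I \<subseteq> S" and red: "reduced I A (u @ [s])"
  shows "act u (simple_root s) x \<ge> 0"
  using red
proof (induction "length u" arbitrary: u s x rule: less_induct)
  case less
  have us: "u \<in> lists I" "s \<in> I" "u @ [s] \<in> lists I" using less.prems by (auto simp: reduced_def)
  have red_u: "reduced I A u" using less.prems reduced_appendD1 by blast
  show ?case
  proof (cases u rule: rev_cases)
    case Nil
    then show ?thesis by (simp add: simple_root_def)
  next
    case (snoc u0 t)
    have t: "t \<in> I" and u0: "u0 \<in> lists I" using us snoc by auto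
    have "t \<noteq> s"
    proof
      assume "t = s"
      then have "weyl_eq I A (u @ [s]) u0"
        using weyl_eq_append_cancel[of u0 I "[]" s A] u0 us snoc by simp
      from reduced_le[OF less.prems this] show False using snoc by simp
    qed
    have alt: "alternating s t k \<in> lists I" "alternating t s k \<in> lists I" for k
      using alternating_in_lists[OF us(2) t] alternating_in_lists[OF t us(2)] by blast+
    define P where "P = (\<lambda>k. \<exists>y \<in> lists I. weyl_eq I A u (y @ alternating s t k) \<and> length y + k = length u)"
    define k where "k = Greatest P"
    have "P 1" unfolding P_def
      by (rule bexI[of _ u0]) (use snoc u0 weyl_eq.refl[OF us(1), of A] in simp_all)
    have bound: "k' \<le> length u" if "P k'" for k' using that by (auto simp: P_def)
    have "P k" unfolding k_def using \<open>P 1\<close> bound by (rule GreatestI_nat)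
    have max: "k' \<le> k" if "P k'" for k'
      unfolding k_def using that bound by (rule Greatest_le_nat)
    then have "1 \<le> k" using \<open>P 1\<close> by blast
    obtain y where y: "y \<in> lists I" "weyl_eq I A u (y @ alternating s t k)" "length y + k = length u"
      using \<open>P k\<close> unfolding P_def by blast
    have red_y: "reduced I A y"
      using reduced_weyl_eq[OF red_u y(2)] y(3) reduced_appendD1 by simp
    have red_yp: "reduced I A (y @ [p])" if p: "p \<in> {s, t}" for p
    proof (rule ccontr)
      have pI: "p \<in> I" using p us t by auto
      assume "\<not> reduced I A (y @ [p])"
      from not_reduced_snoc[OF red_y pI this] obtain z where
        z: "weyl_eq I A y (z @ [p])" "Suc (length z) = length y" by blast
      then have zI: "z \<in> lists I" using weyl_eq_lists by fastforce
      have uz: "weyl_eq I A u (z @ [p] @ alternating s t k)"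
        using weyl_eq.trans[OF y(2) weyl_eq_append_right[OF z(1) alt(1)]] by simp
      show False
      \<comment> \<open>Either \<open>p\<close> prolongs the alternating word, against maximality, or it cancels its first letter.\<close>
      proof (cases "p = (if even k then t else s)")
        case True
        then have "P (Suc k)" unfolding P_def using uz zI z y(3) by (intro bexI[of _ z]) auto
        then show False using max by fastforce
      next
        case False
        obtain k0 where k0: "k = Suc k0" using \<open>1 \<le> k\<close> by (cases k) auto
        then have "alternating s t k = p # alternating s t k0" using False p by auto
        with uz have "weyl_eq I A u (z @ [p, p] @ alternating s t k0)" by simp
        then have "weyl_eq I A u (z @ alternating s t k0)"
          using weyl_eq_append_cancel[OF zI alt(1) pI] weyl_eq.trans by blast
        from reduced_le[OF red_u this] have "length u \<le> length z + k0" by simp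
        then show False using y(3) z(2) k0 by simp
      qed
    qed
    have "length y < length u" using y(3) \<open>1 \<le> k\<close> by simp
    from less.hyps[OF this] have nonneg: "act y (simple_root s) x \<ge> 0" "act y (simple_root t) x \<ge> 0"
      using red_yp by auto
    have k_less: "enat k < coxeter_exponent A s t"
    proof (rule ccontr)
      assume "\<not> enat k < coxeter_exponent A s t"
      then obtain m where m: "coxeter_exponent A s t = enat m" "m \<le> k"
        by (cases "coxeter_exponent A s t") auto
      have "m \<ge> 1" using m(1) by (auto simp: coxeter_exponent_def numeral_eq_enat split: if_splits)
      obtain z where z: "alternating s t k = z @ alternating s t m" "length z = k - m" "set z \<subseteq> {s, t}"
        using alternating_split[OF m(2), of s t] by (elim exE conjE) (rule that)
      obtain z' where z': "alternating t s m = z' @ [s]" "length z' = m - 1" "set z' \<subseteq> {s, t}"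
        using alternating_split[OF \<open>m \<ge> 1\<close>, of t s] by (elim exE conjE) (rule that, simp_all add: insert_commute)
      define r where "r = y @ z @ z'"
      have "z \<in> lists I" "z' \<in> lists I" using z z' us t by auto
      then have r: "r \<in> lists I" using y by (simp add: r_def)
      have "weyl_eq I A (alternating s t m) (z' @ [s])"
        using weyl_eq_alternating_swap[OF us(2) t \<open>t \<noteq> s\<close>[symmetric] m(1)] z' by simp
      then have "weyl_eq I A ((y @ z) @ alternating s t m) ((y @ z) @ z' @ [s])"
        using y \<open>z \<in> lists I\<close> by (intro weyl_eq_append_left) auto
      then have "weyl_eq I A u (r @ [s])" using y(2) z(1) by (auto simp: r_def intro: weyl_eq.trans)
      then have "weyl_eq I A (u @ [s]) ((r @ [s]) @ [s])"
        using us by (intro weyl_eq_append_right) auto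
      moreover have "weyl_eq I A (r @ [s, s] @ []) (r @ [])"
        using us r by (intro weyl_eq_append_cancel) auto
      ultimately have "weyl_eq I A (u @ [s]) r" by (auto intro: weyl_eq.trans)
      from reduced_le[OF less.prems this] have "length (u @ [s]) \<le> length r" .
      then show False using y(3) z(2) z'(2) m \<open>m \<ge> 1\<close> by (simp add: r_def)
    qed
    obtain c d where cd: "string_coeffs (- A s t) (- A t s) k = (c, d)" by force
    have st: "s \<in> S" "t \<in> S" "s \<noteq> t" using us t I \<open>t \<noteq> s\<close> by auto
    have "act u (simple_root s) = act y (act (alternating s t k) (simple_root s))"
      using act_weyl_eq[OF y(2) I] by (simp add: act_append)
    also have "\<dots> = (\<lambda>x. c * act y (simple_root s) x + d * act y (simple_root t) x)"
      by (simp add: act_alternating_simple_root[OF st] cd act_linear)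
    finally show ?thesis using nonneg string_coeffs_nonneg[OF st k_less cd] by simp
  qed
qed

lemma act_snoc_simple_root:
  "s \<in> S \<Longrightarrow> act (u @ [s]) (simple_root s) x = - act u (simple_root s) x"
  using act_linear[of u "-1" "simple_root s" 0 "simple_root s"]
  by (simp add: act_append act_Cons reflect_simple_root)

lemma act_rev: "u \<in> lists S \<Longrightarrow> act (rev u) (act u v) = v"
  using act_weyl_eq[OF weyl_eq_rev_append[of u S A]] by (simp add: act_append fun_eq_iff)

lemma act_simple_root_nonzero:
  assumes "u \<in> lists S" shows "act u (simple_root s) \<noteq> (\<lambda>x. 0)"
proof
  assume "act u (simple_root s) = (\<lambda>x. 0)"
  then have "simple_root s = act (rev u) (\<lambda>x. 0)" using act_rev[OF assms, of "simple_root s"] by simp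
  also have "\<dots> = (\<lambda>x. 0)" using act_linear[of "rev u" 0 "\<lambda>x. 0" 0 "\<lambda>x. 0"] by simp
  finally have "simple_root s s = (0 :: int)" by (rule fun_cong)
  then show False by (simp add: simple_root_def)
qed

text \<open>
  A nonempty reduced word sends the simple root of its last letter to a root with coordinates
  at most zero.
\<close>

lemma reduced_fixing_simple_roots:
  assumes I: "I \<subseteq> S" and r: "reduced I A r" and fix_roots: "\<And>s. s \<in> I \<Longrightarrow> act r (simple_root s) = simple_root s"
  shows "r = []"
proof (cases r rule: rev_cases)
  case (snoc w s)
  then have s: "s \<in> I" using r by (auto simp: reduced_def)
  have "act w (simple_root s) s \<ge> 0" using r unfolding snoc by (rule reduced_snoc_nonneg[OF I])
  moreover have "act w (simple_root s) s = - simple_root s s"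
    using act_snoc_simple_root[of s w s] fix_roots[OF s] s I snoc by auto
  ultimately show ?thesis by (simp add: simple_root_def)
qed


theorem act_faithful:
  assumes "I \<subseteq> S" "u \<in> lists I" "v \<in> lists I"
  shows "act u = act v \<longleftrightarrow> weyl_eq I A u v"
proof
  assume eq: "act u = act v"
  have rv: "rev v @ u \<in> lists I" using assms by auto
  then obtain r where r: "weyl_eq I A (rev v @ u) r" "reduced I A r" using reduced_exists[OF rv, of A] by auto
  have "v \<in> lists S" using assms by auto
  then have id: "act r = id"
    using act_weyl_eq[OF r(1) assms(1)] eq act_rev[of v] by (simp add: act_append fun_eq_iff)
  then have "r = []" using reduced_fixing_simple_roots[OF assms(1) r(2)] by simp
  then have "weyl_eq I A (v @ rev v @ u) v" using weyl_eq_append_left[OF r(1) assms(3)] by simp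
  moreover have "weyl_eq I A ((v @ rev v) @ u) ([] @ u)"
  proof (rule weyl_eq_append_right[OF _ assms(2)])
    have "rev v \<in> lists I" using assms(3) by auto
    from weyl_eq_rev_append[OF this, of A] show "weyl_eq I A (v @ rev v) []" by simp
  qed
  ultimately show "weyl_eq I A u v" by (auto intro: weyl_eq.trans weyl_eq.sym)
qed (use act_weyl_eq assms in blast)

section \<open>Weyl groups as groups of operators\<close>

text \<open>
  By faithfulness, elements of the Weyl group of \<open>A\<^sub>I\<close> may be replaced by operators on the lattice of \<open>S\<close>, so
  that the groups for all \<open>I\<close> become subgroups of one group.
\<close>

definition weyl_ops :: "'i set \<Rightarrow> (('i \<Rightarrow> int) \<Rightarrow> 'i \<Rightarrow> int) set" where
  "weyl_ops I = act ` lists I"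

definition len :: "(('i \<Rightarrow> int) \<Rightarrow> 'i \<Rightarrow> int) \<Rightarrow> nat" where
  "len f = (LEAST k. \<exists>u\<in>lists S. act u = f \<and> length u = k)"

definition ascent :: "(('i \<Rightarrow> int) \<Rightarrow> 'i \<Rightarrow> int) \<Rightarrow> 'i \<Rightarrow> bool" where
  "ascent f s \<longleftrightarrow> (\<forall>x. f (simple_root s) x \<ge> 0)"

lemma reduced_snoc_iff:
  assumes I: "I \<subseteq> S" and u: "reduced I A u" and s: "s \<in> I"
  shows "reduced I A (u @ [s]) \<longleftrightarrow> ascent (act u) s"
proof
  show "ascent (act u) s" if "reduced I A (u @ [s])"
    unfolding ascent_def using reduced_snoc_nonneg[OF I that] by blast
next
  assume asc: "ascent (act u) s"
  show "reduced I A (u @ [s])"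
  proof (rule ccontr)
    assume "\<not> reduced I A (u @ [s])"
    from not_reduced_snoc[OF u s this] obtain v where
      v: "weyl_eq I A u (v @ [s])" "reduced I A (v @ [s])" by blast
    have "s \<in> S" and uS: "u \<in> lists S" using s I u by (auto simp: reduced_def)
    then have "act u (simple_root s) x = - act v (simple_root s) x" for x
      using act_weyl_eq[OF v(1) I] act_snoc_simple_root by simp
    moreover have "act v (simple_root s) x \<ge> 0" for x using reduced_snoc_nonneg[OF I v(2)] .
    ultimately have "act u (simple_root s) = (\<lambda>x. 0)"
      using asc unfolding ascent_def by (intro ext) (metis neg_le_0_iff_le order_antisym)
    then show False using act_simple_root_nonzero[OF uS] by blast
  qed
qed

text \<open>
  Whether a letter lengthens a word depends only on the sign of a root, not on the set of available generators.
  This is why the length on a parabolic subgroup is the restricted one.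
\<close>

lemma reduced_mono:
  assumes "I \<subseteq> S" shows "reduced I A u \<Longrightarrow> reduced S A u"
proof (induction u rule: rev_induct)
  case Nil
  show ?case by (simp add: reduced_def)
next
  case (snoc s u)
  then have u: "reduced I A u" and s: "s \<in> I"
    using reduced_appendD1 by (blast, simp add: reduced_def)
  then show ?case
    using snoc reduced_snoc_iff[of S u s] reduced_snoc_iff[OF assms, of u s] assms by auto
qed

lemma len_reduced:
  assumes "I \<subseteq> S" "reduced I A u" shows "len (act u) = length u"
  unfolding len_def
proof (rule Least_equality)
  have red: "reduced S A u" using reduced_mono assms by blast
  then have u: "u \<in> lists S" by (simp add: reduced_def)
  then show "\<exists>v\<in>lists S. act v = act u \<and> length v = length u" by blast
  fix k assume "\<exists>v\<in>lists S. act v = act u \<and> length v = k"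
  then obtain v where v: "v \<in> lists S" "act v = act u" "length v = k" by blast
  then have "weyl_eq S A u v" using act_faithful[of S u v] u by simp
  from reduced_le[OF red this] show "length u \<le> k" using v by simp
qed

lemma weyl_ops_reduced:
  assumes "I \<subseteq> S" "f \<in> weyl_ops I"
  obtains u where "reduced I A u" "u \<in> lists I" "act u = f" "len f = length u"
proof -
  obtain v where v: "v \<in> lists I" "f = act v" using assms by (auto simp: weyl_ops_def)
  obtain u where u: "weyl_eq I A v u" "reduced I A u" using reduced_exists[OF v(1), of A] by auto
  have "act u = f" using act_weyl_eq[OF u(1) assms(1)] v by simp
  moreover have "u \<in> lists I" using u by (simp add: reduced_def)
  ultimately show ?thesis using that u len_reduced[OF assms(1) u(2)] by blast
qed

lemma weyl_ops_mono: "I \<subseteq> J \<Longrightarrow> weyl_ops I \<subseteq> weyl_ops J"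
  unfolding weyl_ops_def by (intro image_mono lists_mono)

lemma id_in_weyl_ops: "id \<in> weyl_ops I"
  unfolding weyl_ops_def by (rule image_eqI[of _ _ "[]"]) auto

lemma weyl_ops_comp: "f \<in> weyl_ops I \<Longrightarrow> g \<in> weyl_ops I \<Longrightarrow> f \<circ> g \<in> weyl_ops I"
proof -
  assume "f \<in> weyl_ops I" "g \<in> weyl_ops I"
  then obtain u v where "u \<in> lists I" "f = act u" "v \<in> lists I" "g = act v"
    by (auto simp: weyl_ops_def)
  then show "f \<circ> g \<in> weyl_ops I"
    unfolding weyl_ops_def by (intro image_eqI[of _ _ "u @ v"]) (simp_all add: act_append)
qed

lemma act_single: "act [s] = reflect s"
  by (simp add: act_Cons)

lemma reflect_in_weyl_ops: "s \<in> I \<Longrightarrow> reflect s \<in> weyl_ops I"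
  unfolding weyl_ops_def by (rule image_eqI[of _ _ "[s]"]) (auto simp: act_single)

lemma weyl_ops_inverse:
  assumes "I \<subseteq> S" "f \<in> weyl_ops I"
  obtains g where "g \<in> weyl_ops I" "g \<circ> f = id" "f \<circ> g = id"
proof -
  obtain u where u: "u \<in> lists I" "f = act u" using assms by (auto simp: weyl_ops_def)
  then have "u \<in> lists S" "rev u \<in> lists S" "rev u \<in> lists I" using assms by auto
  then show ?thesis using that[of "act (rev u)"] u act_rev[of u] act_rev[of "rev u"]
    by (auto simp: fun_eq_iff weyl_ops_def)
qed

lemma len_ascent:
  assumes "f \<in> weyl_ops S" "s \<in> S" "ascent f s"
  shows "len (f \<circ> reflect s) = Suc (len f)"
proof -
  obtain u where u: "reduced S A u" "act u = f" "len f = length u"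
    using weyl_ops_reduced[OF subset_refl assms(1)] by blast
  then have "reduced S A (u @ [s])" using reduced_snoc_iff[of S u s] assms by simp
  from len_reduced[OF subset_refl this] show ?thesis using u by (simp add: act_append act_single)
qed

lemma len_descent:
  assumes "f \<in> weyl_ops S" "s \<in> S" "\<not> ascent f s"
  shows "len f = Suc (len (f \<circ> reflect s))" "f (simple_root s) x \<le> 0"
proof -
  obtain u where u: "reduced S A u" "act u = f" "len f = length u"
    using weyl_ops_reduced[OF subset_refl assms(1)] by blast
  then have "\<not> reduced S A (u @ [s])" using reduced_snoc_iff[of S u s] assms by simp
  from not_reduced_snoc[OF u(1) assms(2) this] obtain v where
    v: "weyl_eq S A u (v @ [s])" "reduced S A (v @ [s])" "Suc (length v) = length u" by blast
  have f: "f = act v \<circ> reflect s"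
    using act_weyl_eq[OF v(1)] u by (simp add: act_append act_single)
  then have "f \<circ> reflect s = act v" using assms(2) by (simp add: fun_eq_iff reflect_reflect)
  then show "len f = Suc (len (f \<circ> reflect s))"
    using len_reduced[OF subset_refl reduced_appendD1[OF v(2)]] v(3) u by simp
  show "f (simple_root s) x \<le> 0"
    using act_snoc_simple_root[OF assms(2), of v x] reduced_snoc_nonneg[OF subset_refl v(2), of x]
    by (simp add: f act_append act_single)
qed

lemma len_id [simp]: "len id = 0"
  using len_reduced[of S "[]"] by (simp add: reduced_def)

lemma len_eq_0: "f \<in> weyl_ops S \<Longrightarrow> len f = 0 \<Longrightarrow> f = id"
  by (erule weyl_ops_reduced[OF subset_refl]) auto

text \<open>
  Induction along a reduced word. Its prefixes are reduced as well, which supplies the ascents.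
\<close>

lemma weyl_ops_induct [consumes 2, case_names id step]:
  assumes f: "f \<in> weyl_ops I" and I: "I \<subseteq> S" and "P id"
    and step: "\<And>g s. g \<in> weyl_ops I \<Longrightarrow> s \<in> I \<Longrightarrow> ascent g s \<Longrightarrow> P g \<Longrightarrow> P (g \<circ> reflect s)"
  shows "P f"
proof -
  obtain u where u: "reduced I A u" "act u = f" using weyl_ops_reduced[OF I f] by blast
  have "reduced I A u \<Longrightarrow> P (act u)"
  proof (induction u rule: rev_induct)
    case (snoc s u)
    then have u: "reduced I A u" "u \<in> lists I" and s: "s \<in> I"
      using reduced_appendD1 by (blast, simp_all add: reduced_def)
    then have "ascent (act u) s" using reduced_snoc_iff[OF I u(1) s] snoc by simp
    then show ?case
      using step[of "act u" s] u s snoc by (simp add: act_append act_single weyl_ops_def comp_def)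
  qed (simp add: assms)
  with u show ?thesis by simp
qed

lemma act_outside: "x \<notin> set u \<Longrightarrow> act u v x = v x"
  by (induction u) (auto simp: act_Cons reflect_def)

lemma act_sum: "finite J \<Longrightarrow> act u (\<lambda>x. \<Sum>j\<in>J. c j * w j x) = (\<lambda>x. \<Sum>j\<in>J. c j * act u (w j) x)"
proof (induction J rule: finite_induct)
  case empty
  show ?case using act_linear[of u 0 "\<lambda>x. 0" 0 "\<lambda>x. 0"] by simp
next
  case (insert j J)
  then show ?case
    using act_linear[of u "c j" "w j" 1 "\<lambda>x. \<Sum>j\<in>J. c j * w j x"] by simp
qed

text \<open>
  Elements of the subgroup for \<open>I\<close> do not leave the span of the simple roots in \<open>I\<close>, so the signs of
  \<open>f \<alpha>\<^sub>j\<close> for \<open>j \<in> I\<close> control the sign of \<open>f g \<alpha>\<^sub>s\<close>.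
\<close>

lemma comp_simple_root_expand:
  assumes I: "I \<subseteq> S" and f: "f \<in> weyl_ops S" and g: "g \<in> weyl_ops I" and s: "s \<in> I"
  shows "(f \<circ> g) (simple_root s) x = (\<Sum>j\<in>I. g (simple_root s) j * f (simple_root j) x)"
proof -
  obtain u v where u: "f = act u" and v: "v \<in> lists I" "g = act v"
    using f g by (auto simp: weyl_ops_def)
  have fin: "finite I" using I by (rule finite_subset) simp
  have "g (simple_root s) = (\<lambda>x. \<Sum>j\<in>I. g (simple_root s) j * simple_root j x)"
  proof
    fix x
    show "g (simple_root s) x = (\<Sum>j\<in>I. g (simple_root s) j * simple_root j x)"
    proof (cases "x \<in> I")
      case True
      then show ?thesis using fin by (simp add: simple_root_def if_distrib cong: if_cong)
    next
      case False
      then have "x \<notin> set v" "x \<noteq> s" using v s by auto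
      then have "g (simple_root s) x = 0" by (simp add: v act_outside simple_root_def)
      moreover have "(\<Sum>j\<in>I. g (simple_root s) j * simple_root j x) = 0"
        using False by (intro sum.neutral) (auto simp: simple_root_def)
      ultimately show ?thesis by simp
    qed
  qed
  then have "f (g (simple_root s)) = f (\<lambda>x. \<Sum>j\<in>I. g (simple_root s) j * simple_root j x)"
    by (rule arg_cong)
  then show ?thesis using act_sum[OF fin, of u] by (simp add: u)
qed

section \<open>Parabolic factorization\<close>

definition min_reps :: "'i set \<Rightarrow> (('i \<Rightarrow> int) \<Rightarrow> 'i \<Rightarrow> int) set" where
  "min_reps I = {f \<in> weyl_ops S. \<forall>s\<in>I. ascent f s}"

text \<open>
  If \<open>g \<alpha>\<^sub>s\<close> is a nonnegative combination of simple roots in \<open>I\<close>, then so is its image under \<open>f\<close>, a combination of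
  nonnegative vectors. So each ascent of a reduced word for \<open>g\<close> remains one after \<open>f\<close>.
\<close>

lemma len_min_rep_comp:
  assumes I: "I \<subseteq> S" and f: "f \<in> min_reps I" and g: "g \<in> weyl_ops I"
  shows "len (f \<circ> g) = len f + len g"
  using g I
proof (induction rule: weyl_ops_induct)
  case (step g s)
  have fS: "f \<in> weyl_ops S" and gS: "g \<in> weyl_ops S" and s: "s \<in> S"
    using f step I weyl_ops_mono[OF I] by (auto simp: min_reps_def)
  have "(f \<circ> g) (simple_root s) x \<ge> 0" for x
    unfolding comp_simple_root_expand[OF I fS step(1,2)]
    using step f by (intro sum_nonneg mult_nonneg_nonneg) (auto simp: ascent_def min_reps_def)
  then have "len (f \<circ> g \<circ> reflect s) = Suc (len (f \<circ> g))"
    using fS gS s by (intro len_ascent weyl_ops_comp) (auto simp: ascent_def)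
  then show ?case using step len_ascent[OF gS s] by (simp add: comp_def)
qed (simp_all add: len_id[unfolded id_def])

text \<open>
  The mirror image of \<open>len_min_rep_comp\<close>: if \<open>f\<close> makes all simple roots nonpositive, each ascent of \<open>g\<close> becomes a
  descent of \<open>f \<circ> g\<close>.
\<close>

lemma len_longest_comp:
  assumes f: "f \<in> weyl_ops S" and desc: "\<And>s. s \<in> S \<Longrightarrow> \<not> ascent f s" and g: "g \<in> weyl_ops S"
  shows "len (f \<circ> g) + len g = len f"
  using g subset_refl
proof (induction rule: weyl_ops_induct)
  case (step g s)
  have fg: "f \<circ> g \<in> weyl_ops S" using f step by (intro weyl_ops_comp)
  have nonpos: "(f \<circ> g) (simple_root s) x \<le> 0" for x
    unfolding comp_simple_root_expand[OF subset_refl f step(1,2)]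
    using step len_descent(2)[OF f _ desc]
    by (intro sum_nonpos mult_nonneg_nonpos) (auto simp: ascent_def)
  have "\<not> ascent (f \<circ> g) s"
  proof
    assume "ascent (f \<circ> g) s"
    with nonpos have zero: "(f \<circ> g) (simple_root s) = (\<lambda>x. 0)"
      by (intro ext order_antisym) (auto simp: ascent_def)
    obtain u where "u \<in> lists S" "f \<circ> g = act u" using fg by (auto simp: weyl_ops_def)
    then show False using act_simple_root_nonzero[of u s] zero by simp
  qed
  from len_descent(1)[OF fg step(2) this] show ?case
    using step len_ascent[OF step(1,2)] by (simp add: comp_def)
qed (simp_all add: len_id[unfolded id_def])

text \<open>
  Strip descents in \<open>I\<close> from the right until none is left.
\<close>

lemma min_rep_decomp:
  assumes I: "I \<subseteq> S" and f: "f \<in> weyl_ops S"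
  shows "\<exists>x\<in>min_reps I. \<exists>y\<in>weyl_ops I. f = x \<circ> y"
  using f
proof (induction "len f" arbitrary: f rule: less_induct)
  case less
  show ?case
  proof (cases "f \<in> min_reps I")
    case True
    then show ?thesis using id_in_weyl_ops by (metis comp_id)
  next
    case False
    then obtain s where s: "s \<in> I" "\<not> ascent f s" using less by (auto simp: min_reps_def)
    have "f \<circ> reflect s \<in> weyl_ops S" using less s I by (intro weyl_ops_comp reflect_in_weyl_ops) auto
    moreover have "len f = Suc (len (f \<circ> reflect s))" using len_descent(1) less s I by blast
    ultimately obtain x y where xy: "x \<in> min_reps I" "y \<in> weyl_ops I" "f \<circ> reflect s = x \<circ> y"
      using less.hyps[of "f \<circ> reflect s"] by auto
    have "f = (f \<circ> reflect s) \<circ> reflect s" using s I by (auto simp: fun_eq_iff reflect_reflect)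
    also have "\<dots> = x \<circ> (y \<circ> reflect s)" using xy by (simp add: comp_assoc)
    finally show ?thesis using xy s weyl_ops_comp reflect_in_weyl_ops by blast
  qed
qed

text \<open>
  Two minimal representatives of the same coset differ by an element of the subgroup, and each of them
  is at least as long as the other by the length of that element.
\<close>

lemma min_rep_unique:
  assumes I: "I \<subseteq> S" and x: "x \<in> min_reps I" "x' \<in> min_reps I"
    and y: "y \<in> weyl_ops I" "y' \<in> weyl_ops I" and eq: "x \<circ> y = x' \<circ> y'"
  shows "x = x' \<and> y = y'"
proof -
  obtain z where z: "z \<in> weyl_ops I" "z \<circ> y = id" "y \<circ> z = id" using weyl_ops_inverse[OF I y(1)] by blast
  obtain z' where z': "z' \<in> weyl_ops I" "z' \<circ> y' = id" "y' \<circ> z' = id" using weyl_ops_inverse[OF I y(2)] by blast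
  have "x = (x \<circ> y) \<circ> z" using z by (simp add: comp_assoc)
  then have 1: "x = x' \<circ> (y' \<circ> z)" using eq by (simp add: comp_assoc)
  have "x' = (x' \<circ> y') \<circ> z'" using z' by (simp add: comp_assoc)
  then have 2: "x' = x \<circ> (y \<circ> z')" using eq[symmetric] by (simp add: comp_assoc)
  have in_I: "y' \<circ> z \<in> weyl_ops I" "y \<circ> z' \<in> weyl_ops I" using y z z' by (auto intro: weyl_ops_comp)
  have "len x = len x' + len (y' \<circ> z)" "len x' = len x + len (y \<circ> z')"
    using len_min_rep_comp[OF I x(2) in_I(1), folded 1] len_min_rep_comp[OF I x(1) in_I(2), folded 2]
    by this
  then have "y' \<circ> z = id" using len_eq_0 in_I weyl_ops_mono[OF I] by auto
  then have "y' = y" using z by (metis comp_assoc comp_id id_comp)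
  with 1 \<open>y' \<circ> z = id\<close> show ?thesis by simp
qed

lemma finite_len: "finite {f \<in> weyl_ops S. len f = k}"
proof (rule finite_subset)
  show "{f \<in> weyl_ops S. len f = k} \<subseteq> act ` {u. set u \<subseteq> S \<and> length u = k}"
    by (auto elim!: weyl_ops_reduced[OF subset_refl])
  show "finite (act ` {u. set u \<subseteq> S \<and> length u = k})"
    by (intro finite_imageI finite_lists_length_eq) simp
qed

section \<open>Length series\<close>

definition length_series :: "(('i \<Rightarrow> int) \<Rightarrow> 'i \<Rightarrow> int) set \<Rightarrow> int fps" where
  "length_series X = Abs_fps (\<lambda>k. int (card {f \<in> X. len f = k}))"

theorem length_series_factor:
  assumes I: "I \<subseteq> S"
  shows "length_series (weyl_ops S) = length_series (min_reps I) * length_series (weyl_ops I)"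
proof (rule fps_ext)
  fix k
  let ?X = "\<lambda>i. {f \<in> min_reps I. len f = i}" and ?Y = "\<lambda>i. {f \<in> weyl_ops I. len f = i}"
  have fin: "finite (?X i)" "finite (?Y i)" for i
    using weyl_ops_mono[OF I] by (auto intro!: finite_subset[OF _ finite_len[of i]] simp: min_reps_def)
  have "bij_betw (\<lambda>(x, y). x \<circ> y) (\<Union>i\<in>{0..k}. ?X i \<times> ?Y (k - i)) {f \<in> weyl_ops S. len f = k}"
    unfolding bij_betw_def
  proof
    show "inj_on (\<lambda>(x, y). x \<circ> y) (\<Union>i\<in>{0..k}. ?X i \<times> ?Y (k - i))"
      using min_rep_unique[OF I] by (auto simp: inj_on_def)
    show "(\<lambda>(x, y). x \<circ> y) ` (\<Union>i\<in>{0..k}. ?X i \<times> ?Y (k - i)) = {f \<in> weyl_ops S. len f = k}"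
    proof (intro equalityI subsetI)
      fix f assume "f \<in> (\<lambda>(x, y). x \<circ> y) ` (\<Union>i\<in>{0..k}. ?X i \<times> ?Y (k - i))"
      then obtain x y where "x \<in> min_reps I" "y \<in> weyl_ops I" "f = x \<circ> y" "len x + len y = k"
        by auto
      then show "f \<in> {f \<in> weyl_ops S. len f = k}"
        using len_min_rep_comp[OF I, of x y] weyl_ops_mono[OF I] weyl_ops_comp[of x S y]
        by (auto simp: min_reps_def)
    next
      fix f assume "f \<in> {f \<in> weyl_ops S. len f = k}"
      moreover then obtain x y where xy: "x \<in> min_reps I" "y \<in> weyl_ops I" "f = x \<circ> y"
        using min_rep_decomp[OF I] by blast
      ultimately have "len x + len y = k" using len_min_rep_comp[OF I xy(1,2)] by simp
      then have "(x, y) \<in> (\<Union>i\<in>{0..k}. ?X i \<times> ?Y (k - i))" using xy by auto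
      then show "f \<in> (\<lambda>(x, y). x \<circ> y) ` (\<Union>i\<in>{0..k}. ?X i \<times> ?Y (k - i))" using xy(3) by (intro image_eqI[of _ _ "(x, y)"]) simp_all
    qed
  qed
  from bij_betw_same_card[OF this]
  have "card {f \<in> weyl_ops S. len f = k} = card (\<Union>i\<in>{0..k}. ?X i \<times> ?Y (k - i))" by (rule HOL.sym)
  also have "\<dots> = (\<Sum>i\<in>{0..k}. card (?X i \<times> ?Y (k - i)))"
    using fin by (intro card_UN_disjoint) auto
  finally show "length_series (weyl_ops S) $ k = (length_series (min_reps I) * length_series (weyl_ops I)) $ k"
    by (simp add: length_series_def fps_mult_nth card_cartesian_product)
qed

theorem alternating_sum_min_reps:
  assumes inf: "infinite (weyl_ops S)"
  shows "(\<Sum>I\<in>Pow S. (-1) ^ card I * length_series (min_reps I)) = 0"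
proof (rule fps_ext)
  fix k
  define F where "F = {f \<in> weyl_ops S. len f = k}"
  have fin: "finite F" unfolding F_def by (rule finite_len)
  have asc: "\<exists>s\<in>S. ascent f s" if f: "f \<in> weyl_ops S" for f
  proof (rule ccontr)
    assume "\<not> (\<exists>s\<in>S. ascent f s)"
    then have "len g \<le> len f" if "g \<in> weyl_ops S" for g using len_longest_comp[OF f _ that] by fastforce
    then have "weyl_ops S \<subseteq> (\<Union>k\<le>len f. {g \<in> weyl_ops S. len g = k})" by auto
    moreover have "finite \<dots>" using finite_len by blast
    ultimately show False using inf finite_subset by blast
  qed
  have "(-1) ^ card I * length_series (min_reps I) $ k = (\<Sum>f\<in>F. if I \<subseteq> {s\<in>S. ascent f s} then (-1) ^ card I else 0)"
    if "I \<in> Pow S" for I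
  proof -
    have "{f \<in> min_reps I. len f = k} = {f \<in> F. I \<subseteq> {s\<in>S. ascent f s}}"
      using that by (auto simp: F_def min_reps_def)
    then show ?thesis using fin by (simp add: length_series_def sum.If_cases Int_def mult.commute)
  qed
  then have "(\<Sum>I\<in>Pow S. (-1) ^ card I * length_series (min_reps I) $ k) =
      (\<Sum>I\<in>Pow S. \<Sum>f\<in>F. if I \<subseteq> {s\<in>S. ascent f s} then (-1) ^ card I else 0)"
    by (intro sum.cong) auto
  also have "\<dots> = (\<Sum>f\<in>F. \<Sum>I\<in>Pow S. if I \<subseteq> {s\<in>S. ascent f s} then (-1) ^ card I else 0)"
    by (rule sum.swap)
  also have "\<dots> = (\<Sum>f\<in>F. \<Sum>I\<in>Pow {s\<in>S. ascent f s}. (-1) ^ card I)"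
  proof (rule sum.cong[OF HOL.refl])
    fix f
    have "Pow {s\<in>S. ascent f s} = {I \<in> Pow S. I \<subseteq> {s\<in>S. ascent f s}}" by blast
    then show "(\<Sum>I\<in>Pow S. if I \<subseteq> {s\<in>S. ascent f s} then (-1) ^ card I else 0) =
        (\<Sum>I\<in>Pow {s\<in>S. ascent f s}. (-1 :: int) ^ card I)"
      by (simp only: sum.inter_filter finite_Pow_iff finite_S)
  qed
  also have "\<dots> = 0"
  proof (rule sum.neutral, rule ballI)
    fix f assume "f \<in> F"
    then have "card {s\<in>S. ascent f s} \<noteq> 0" using asc by (subst card_0_eq) (auto simp: F_def)
    then show "(\<Sum>I\<in>Pow {s\<in>S. ascent f s}. (-1) ^ card I) = (0 :: int)"
      using prod_diff_conv_sum[of "{s\<in>S. ascent f s}" "\<lambda>_. 1 :: int" "\<lambda>_. 1"]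
      by (simp add: power_0_left del: card_0_eq card_eq_0_iff)
  qed
  finally have "(\<Sum>I\<in>Pow S. (-1) ^ card I * length_series (min_reps I) $ k) = 0" .
  moreover have "((-1) ^ card I * length_series (min_reps I)) $ k = (-1) ^ card I * length_series (min_reps I) $ k" for I
    by (cases "even (card I)") auto
  ultimately show "(\<Sum>I\<in>Pow S. (-1) ^ card I * length_series (min_reps I)) $ k = (0 :: int fps) $ k"
    by (simp add: fps_sum_nth)
qed

text \<open>
  An element of the presented group is a class of words, which is the fibre of the action over one operator.
\<close>

lemma length_series_eq_poincare:
  assumes I: "I \<subseteq> S"
  shows "poincare_series I A = length_series (weyl_ops I)"
    and "finite (carrier (weyl_group I A)) \<longleftrightarrow> finite (weyl_ops I)"
proof -
  define cls where "cls = (\<lambda>f. {u \<in> lists I. act u = f})"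
  have rel: "weyl_rel I A `` {u} = cls (act u)" if u: "u \<in> lists I" for u
  proof (intro Set.set_eqI iffI)
    fix v
    show "v \<in> weyl_rel I A `` {u}" if "v \<in> cls (act u)"
      using that act_faithful[OF I u, of v] by (simp add: cls_def weyl_rel_def)
    show "v \<in> cls (act u)" if "v \<in> weyl_rel I A `` {u}"
    proof -
      have "weyl_eq I A u v" using that by (simp add: weyl_rel_def)
      then show ?thesis using weyl_eq_lists[of I A u v] act_weyl_eq[of I u v] I by (simp add: cls_def)
    qed
  qed
  have carrier: "carrier (weyl_group I A) = cls ` weyl_ops I"
  proof -
    have "carrier (weyl_group I A) = (\<lambda>u. weyl_rel I A `` {u}) ` lists I"
      by (simp add: weyl_group_def quotient_def UNION_singleton_eq_range)
    also have "\<dots> = (\<lambda>u. cls (act u)) ` lists I" by (rule image_cong[OF HOL.refl rel])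
    finally show ?thesis by (simp add: weyl_ops_def image_image)
  qed
  have inj: "inj_on cls (weyl_ops I)"
  proof (rule inj_onI)
    fix f g assume "f \<in> weyl_ops I" "g \<in> weyl_ops I" and eq: "cls f = cls g"
    then obtain u where "u \<in> lists I" "act u = f" by (auto simp: weyl_ops_def)
    then have "u \<in> cls g" unfolding eq[symmetric] by (simp add: cls_def)
    then show "f = g" using \<open>act u = f\<close> by (simp add: cls_def)
  qed
  show "finite (carrier (weyl_group I A)) \<longleftrightarrow> finite (weyl_ops I)"
    unfolding carrier using inj by (rule finite_image_iff)
  have len: "weyl_length (cls f) = len f" if f: "f \<in> weyl_ops I" for f
  proof -
    obtain u where u: "reduced I A u" "u \<in> lists I" "act u = f" "len f = length u"
      using weyl_ops_reduced[OF I f] by blast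
    show ?thesis unfolding weyl_length_def
    proof (rule Least_equality)
      show "\<exists>v\<in>cls f. length v = len f" using u by (auto simp: cls_def)
      fix k assume "\<exists>v\<in>cls f. length v = k"
      then obtain v where v: "v \<in> lists I" "act v = f" "length v = k" by (auto simp: cls_def)
      then have "weyl_eq I A u v" using act_faithful[OF I u(2) v(1)] u by simp
      from reduced_le[OF u(1) this] show "len f \<le> k" using u v by simp
    qed
  qed
  show "poincare_series I A = length_series (weyl_ops I)"
  proof (rule fps_ext)
    fix k
    have "{w \<in> carrier (weyl_group I A). weyl_length w = k} = cls ` {f \<in> weyl_ops I. len f = k}"
      unfolding carrier using len by auto
    then have "card {w \<in> carrier (weyl_group I A). weyl_length w = k} = card {f \<in> weyl_ops I. len f = k}"
      using inj by (simp add: card_image inj_on_subset)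
    then show "poincare_series I A $ k = length_series (weyl_ops I) $ k"
      by (simp add: poincare_series_def length_series_def)
  qed
qed

section \<open>Finite Weyl groups and finite type\<close>

lemma weyl_ops_eqI:
  assumes f: "f \<in> weyl_ops S" and g: "g \<in> weyl_ops S"
    and eq: "\<And>s. s \<in> S \<Longrightarrow> f (simple_root s) = g (simple_root s)"
  shows "f = g"
proof -
  obtain h where h: "h \<in> weyl_ops S" "h \<circ> g = id" "g \<circ> h = id"
    using weyl_ops_inverse[OF subset_refl g] by blast
  obtain r where r: "reduced S A r" "act r = h \<circ> f"
    using weyl_ops_reduced[OF subset_refl weyl_ops_comp[OF h(1) f]] by blast
  have "act r (simple_root s) = simple_root s" if "s \<in> S" for s
    using eq[OF that] fun_cong[OF h(2), of "simple_root s"] by (simp add: r)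
  then have "r = []" using reduced_fixing_simple_roots[OF subset_refl r(1)] by blast
  then have "h \<circ> f = id" using r by simp
  then have "g \<circ> (h \<circ> f) = g" by simp
  then show ?thesis using h(3) by (metis comp_assoc id_comp)
qed

lemma reflect_linear_form: "reflect i v = (\<lambda>k. 1 * v k + (- coroot i v) * simple_root i k)"
  by (auto simp: reflect_def simple_root_def)

text \<open>
  The bilinear form with Gram matrix \<open>(d i \<cdot> A i j)\<close>.
\<close>

definition form :: "('i \<Rightarrow> real) \<Rightarrow> ('i \<Rightarrow> int) \<Rightarrow> ('i \<Rightarrow> int) \<Rightarrow> real" where
  "form d v w = (\<Sum>i\<in>S. d i * of_int (v i) * of_int (coroot i w))"

context
  fixes d :: "'i \<Rightarrow> real"
  assumes symmetrizable: "\<And>i j. i \<in> S \<Longrightarrow> j \<in> S \<Longrightarrow> d i * of_int (A i j) = d j * of_int (A j i)"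
begin

lemma form_linear:
  "form d (\<lambda>k. a * v k + b * w k) z = of_int a * form d v z + of_int b * form d w z"
  by (simp add: form_def sum_distrib_left sum.distrib[symmetric] algebra_simps)

lemma form_sym: "form d v w = form d w v"
proof -
  have "form d v w = (\<Sum>i\<in>S. \<Sum>j\<in>S. of_int (v i) * of_int (w j) * (d i * of_int (A i j)))"
    by (simp add: form_def coroot_def sum_distrib_left mult_ac)
  also have "\<dots> = (\<Sum>i\<in>S. \<Sum>j\<in>S. of_int (v i) * of_int (w j) * (d j * of_int (A j i)))"
    using symmetrizable by (intro sum.cong) auto
  also have "\<dots> = (\<Sum>j\<in>S. \<Sum>i\<in>S. of_int (v i) * of_int (w j) * (d j * of_int (A j i)))"
    by (rule sum.swap)
  also have "\<dots> = form d w v"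
    by (simp add: form_def coroot_def sum_distrib_left mult_ac)
  finally show ?thesis .
qed

lemma form_simple_root:
  assumes "i \<in> S" shows "form d (simple_root i) w = d i * of_int (coroot i w)"
proof -
  have "form d (simple_root i) w = (\<Sum>j\<in>S. if j = i then d i * of_int (coroot i w) else 0)"
    unfolding form_def simple_root_def by (intro sum.cong) auto
  then show ?thesis using assms by simp
qed

lemma form_square_shift:
  assumes i: "i \<in> S"
  shows "form d (\<lambda>k. a * v k + b * simple_root i k) (\<lambda>k. a * v k + b * simple_root i k) =
    of_int (a * a) * form d v v + 2 * of_int (a * b * coroot i v) * d i + 2 * of_int (b * b) * d i"
proof -
  let ?z = "\<lambda>k. a * v k + b * simple_root i k"
  have 1: "form d v ?z = of_int a * form d v v + of_int b * (d i * of_int (coroot i v))"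
    using form_sym[of v ?z] form_linear[of a v b "simple_root i" v] form_simple_root[OF i, of v] by simp
  have 2: "coroot i ?z = a * coroot i v + b * 2"
    using coroot_linear[of i a v b "simple_root i"] i by (simp add: coroot_simple_root diag)
  show ?thesis
    unfolding form_linear[of a v b "simple_root i" ?z] 1 form_simple_root[OF i] 2 by (simp add: algebra_simps)
qed

lemma form_act: "u \<in> lists S \<Longrightarrow> form d (act u v) (act u v) = form d v v"
proof (induction u)
  case (Cons i u)
  then have "i \<in> S" by auto
  from form_square_shift[OF this, of 1 "act u v" "- coroot i (act u v)"] Cons
  show ?case by (simp add: act_Cons reflect_linear_form)
qed simp

end

text \<open>
  An operator \<open>f\<close> is determined by the integers \<open>\<langle>\<alpha>\<^sub>j\<^sup>v, f \<alpha>\<^sub>i\<rangle>\<close>, since a vector on which all coroots vanish has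
  norm zero. As \<open>f \<alpha>\<^sub>i\<close> has the same norm as \<open>\<alpha>\<^sub>i\<close>, the Cauchy-Schwarz inequality bounds these integers.
\<close>

theorem finite_type_imp_finite_weyl_ops:
  assumes "finite_type S A"
  shows "finite (weyl_ops S)"
proof -
  obtain d :: "'i \<Rightarrow> real" where d: "\<And>i. i \<in> S \<Longrightarrow> d i > 0"
    and sym: "\<And>i j. i \<in> S \<Longrightarrow> j \<in> S \<Longrightarrow> d i * of_int (A i j) = d j * of_int (A j i)"
    and pos: "\<And>x :: 'i \<Rightarrow> real. \<exists>i\<in>S. x i \<noteq> 0 \<Longrightarrow> (\<Sum>i\<in>S. \<Sum>j\<in>S. x i * (d i * of_int (A i j)) * x j) > 0"
    using assms unfolding finite_type_def by blast
  have form_pos: "form d v v > 0" if "\<exists>i\<in>S. v i \<noteq> 0" for v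
    using pos[of "\<lambda>i. of_int (v i)"] that by (simp add: form_def coroot_def sum_distrib_left mult_ac)
  have form_nonneg: "form d v v \<ge> 0" for v
  proof (cases "\<exists>i\<in>S. v i \<noteq> 0")
    case True
    then show ?thesis using form_pos[of v] by simp
  next
    case False
    then show ?thesis by (simp add: form_def)
  qed
  define B where "B = (\<lambda>(i, j). {- \<lfloor>4 * d i / d j\<rfloor> .. \<lfloor>4 * d i / d j\<rfloor>})"
  define entries where "entries = (\<lambda>f. restrict (\<lambda>(i, j). coroot j (f (simple_root i))) (S \<times> S))"
  have "entries f \<in> PiE (S \<times> S) B" if f: "f \<in> weyl_ops S" for f
  proof -
    have "coroot j (f (simple_root i)) \<in> B (i, j)" if ij: "i \<in> S" "j \<in> S" for i j
    proof -
      let ?v = "f (simple_root i)" and ?c = "coroot j (f (simple_root i))"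
      have "form d ?v ?v = form d (simple_root i) (simple_root i)"
        using f form_act[OF sym] by (auto simp: weyl_ops_def simp del: in_lists_conv_set)
      also have "\<dots> = 2 * d i"
        using ij by (simp add: form_simple_root[OF sym] coroot_simple_root diag)
      finally have v: "form d ?v ?v = 2 * d i" .
      \<comment> \<open>Cauchy-Schwarz within the lattice: twice the component of \<open>f \<alpha>\<^sub>i\<close> orthogonal to \<open>\<alpha>\<^sub>j\<close> is integral.\<close>
      have "0 \<le> form d (\<lambda>k. 2 * ?v k + (- ?c) * simple_root j k) (\<lambda>k. 2 * ?v k + (- ?c) * simple_root j k)"
        by (rule form_nonneg)
      also have "\<dots> = 8 * d i - 2 * of_int (?c * ?c) * d j"
        by (subst form_square_shift[OF sym ij(2)]) (simp_all add: v algebra_simps)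
      finally have "of_int (?c * ?c) \<le> 4 * d i / d j"
        using d[OF ij(2)] by (simp add: field_simps)
      then have "?c * ?c \<le> \<lfloor>4 * d i / d j\<rfloor>" by (simp only: le_floor_iff)
      moreover have "\<bar>?c\<bar> \<le> ?c * ?c"
      proof (cases "?c = 0")
        case False
        then have "\<bar>?c\<bar> * 1 \<le> \<bar>?c\<bar> * \<bar>?c\<bar>" by (intro mult_left_mono) auto
        then show ?thesis by simp
      qed simp
      ultimately show ?thesis unfolding B_def by auto
    qed
    then show ?thesis unfolding entries_def by auto
  qed
  then have "entries ` weyl_ops S \<subseteq> PiE (S \<times> S) B" by blast
  moreover have "finite (PiE (S \<times> S) B)" by (intro finite_PiE) (auto simp: B_def)
  ultimately have "finite (entries ` weyl_ops S)" by (rule finite_subset)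
  moreover have "inj_on entries (weyl_ops S)"
  proof (rule inj_onI, rule weyl_ops_eqI)
    fix f g i assume f: "f \<in> weyl_ops S" and g: "g \<in> weyl_ops S" and eq: "entries f = entries g" and i: "i \<in> S"
    define v where "v = (\<lambda>k. 1 * f (simple_root i) k + (- 1) * g (simple_root i) k)"
    have "coroot j (f (simple_root i)) = coroot j (g (simple_root i))" if "j \<in> S" for j
      using fun_cong[OF eq, of "(i, j)"] i that by (simp add: entries_def)
    then have "coroot j v = 0" if "j \<in> S" for j
      unfolding v_def coroot_linear using that by simp
    then have "form d v v = 0" by (simp add: form_def)
    then have in_S: "v k = 0" if "k \<in> S" for k using form_pos[of v] that by force
    have out_S: "h (simple_root i) k = simple_root i k" if "k \<notin> S" "h \<in> weyl_ops S" for h k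
      using that act_outside by (auto simp: weyl_ops_def)
    show "f (simple_root i) = g (simple_root i)"
    proof
      fix k show "f (simple_root i) k = g (simple_root i) k"
        using in_S[of k] out_S[OF _ f, of k] out_S[OF _ g, of k] by (cases "k \<in> S") (auto simp: v_def)
    qed
  qed
  ultimately show ?thesis by (rule finite_imageD)
qed

text \<open>
  Let \<open>M\<close> be the Gram matrix of the simple roots for the scalar product averaged over the group. Reindexing the
  average by \<open>f \<mapsto> f \<circ> reflect i\<close> gives \<open>2 M i j = A i j \<cdot> M i i\<close>, so the diagonal of \<open>M\<close>
  symmetrizes \<open>A\<close>, and the quadratic form is a sum of squares.
\<close>

theorem finite_weyl_ops_imp_finite_type:
  assumes fin: "finite (weyl_ops S)"
  shows "finite_type S A"
proof -
  define M where "M = (\<lambda>i j. \<Sum>f\<in>weyl_ops S. \<Sum>k\<in>S. f (simple_root i) k * f (simple_root j) k)"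
  have M_sym: "M i j = M j i" for i j by (simp add: M_def mult.commute)
  have double: "2 * M i j = A i j * M i i" if ij: "i \<in> S" "j \<in> S" for i j
  proof -
    have shift: "f (reflect i (simple_root m)) k = f (simple_root m) k - A i m * f (simple_root i) k"
      if f: "f \<in> weyl_ops S" and m: "m \<in> S" for f m k
    proof -
      obtain u where u: "f = act u" using f by (auto simp: weyl_ops_def)
      show ?thesis
        unfolding reflect_linear_form u act_linear using m by (simp add: coroot_simple_root)
    qed
    have "M i j = (\<Sum>f\<in>weyl_ops S. \<Sum>k\<in>S. (f \<circ> reflect i) (simple_root i) k * (f \<circ> reflect i) (simple_root j) k)"
      unfolding M_def
    proof (rule sum.reindex_bij_witness[of _ "\<lambda>f. f \<circ> reflect i" "\<lambda>f. f \<circ> reflect i"])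
      fix f assume "f \<in> weyl_ops S"
      then show "f \<circ> reflect i \<in> weyl_ops S" "f \<circ> reflect i \<in> weyl_ops S"
        using ij by (auto intro!: weyl_ops_comp reflect_in_weyl_ops)
    qed (use ij in \<open>auto simp: fun_eq_iff reflect_reflect\<close>)
    also have "\<dots> = (\<Sum>f\<in>weyl_ops S. \<Sum>k\<in>S. A i j * (f (simple_root i) k * f (simple_root i) k)
        - f (simple_root i) k * f (simple_root j) k)"
    proof (intro sum.cong HOL.refl)
      fix f k assume f: "f \<in> weyl_ops S"
      show "(f \<circ> reflect i) (simple_root i) k * (f \<circ> reflect i) (simple_root j) k =
          A i j * (f (simple_root i) k * f (simple_root i) k) - f (simple_root i) k * f (simple_root j) k"
        unfolding comp_apply shift[OF f ij(1)] shift[OF f ij(2)] by (simp add: diag[OF ij(1)] algebra_simps)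
    qed
    also have "\<dots> = A i j * M i i - M i j"
      by (simp add: M_def sum_subtractf flip: sum_distrib_left)
    finally show ?thesis by simp
  qed
  have M_pos: "M i i > 0" if "i \<in> S" for i
  proof -
    have "(0 :: int) < (\<Sum>k\<in>S. simple_root i k * simple_root i k)"
      by (rule sum_pos2[of _ i]) (use that in \<open>auto simp: simple_root_def\<close>)
    also have "\<dots> = (\<Sum>k\<in>S. id (simple_root i) k * id (simple_root i) k)" by simp
    also have "\<dots> \<le> M i i"
      unfolding M_def by (rule member_le_sum[OF id_in_weyl_ops]) (use fin in \<open>auto intro: sum_nonneg\<close>)
    finally show ?thesis .
  qed
  show ?thesis
    unfolding finite_type_def
  proof (intro exI[of _ "\<lambda>i. of_int (M i i)"] conjI ballI allI impI)
    fix i assume "i \<in> S" then show "0 < (of_int (M i i) :: real)" using M_pos by simp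
  next
    fix i j assume ij: "i \<in> S" "j \<in> S"
    then have "M i i * A i j = M j j * A j i"
      using double[of i j] double[of j i] M_sym[of i j] by (simp add: mult.commute)
    then show "of_int (M i i) * of_int (A i j) = (of_int (M j j) * of_int (A j i) :: real)"
      by (metis of_int_mult)
  next
    fix x :: "'i \<Rightarrow> real" assume x: "\<exists>i\<in>S. x i \<noteq> 0"
    \<comment> \<open>\<open>?y f k\<close> is the \<open>k\<close>-th coordinate of \<open>f\<close> applied to the real vector with coordinates \<open>x\<close>.\<close>
    let ?y = "\<lambda>f k. \<Sum>i\<in>S. x i * of_int (f (simple_root i) k)"
    have "0 < (\<Sum>k\<in>S. ?y id k * ?y id k)"
    proof -
      have "?y id k = x k" if "k \<in> S" for k
      proof -
        have "?y id k = (\<Sum>i\<in>S. if i = k then x k else 0)" by (intro sum.cong) (auto simp: simple_root_def)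
        then show ?thesis using that by simp
      qed
      then have "(\<Sum>k\<in>S. ?y id k * ?y id k) = (\<Sum>k\<in>S. x k * x k)" by (intro sum.cong) auto
      moreover obtain i where "i \<in> S" "x i \<noteq> 0" using x by blast
      then have "0 < (\<Sum>k\<in>S. x k * x k)" by (intro sum_pos2[of _ i]) (auto simp: zero_less_mult_iff)
      ultimately show ?thesis by simp
    qed
    also have "\<dots> \<le> (\<Sum>f\<in>weyl_ops S. \<Sum>k\<in>S. ?y f k * ?y f k)"
      by (rule member_le_sum[OF id_in_weyl_ops]) (use fin in \<open>auto intro: sum_nonneg\<close>)
    also have "\<dots> = (\<Sum>f\<in>weyl_ops S. \<Sum>k\<in>S. \<Sum>i\<in>S. \<Sum>j\<in>S.
        x i * x j * of_int (f (simple_root i) k * f (simple_root j) k))"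
      by (simp add: sum_product mult_ac)
    also have "\<dots> = (\<Sum>i\<in>S. \<Sum>j\<in>S. \<Sum>f\<in>weyl_ops S. \<Sum>k\<in>S.
        x i * x j * of_int (f (simple_root i) k * f (simple_root j) k))"
      by (subst (2) sum.swap, subst sum.swap, subst (3) sum.swap, subst (2) sum.swap) (rule HOL.refl)
    also have "\<dots> = (\<Sum>i\<in>S. \<Sum>j\<in>S. x i * x j * of_int (M i j))"
      by (simp add: M_def sum_distrib_left)
    finally have "0 < 2 * (\<Sum>i\<in>S. \<Sum>j\<in>S. x i * x j * of_int (M i j))" by simp
    also have "\<dots> = (\<Sum>i\<in>S. \<Sum>j\<in>S. x i * (of_int (M i i) * of_int (A i j)) * x j)"
      unfolding sum_distrib_left
    proof (intro sum.cong HOL.refl)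
      fix i j assume "i \<in> S" "j \<in> S"
      then have "of_int (M i i) * of_int (A i j) = (2 * of_int (M i j) :: real)"
        using double[of i j] by (metis mult.commute of_int_mult of_int_numeral)
      then show "2 * (x i * x j * of_int (M i j)) = x i * (of_int (M i i) * of_int (A i j)) * x j" by simp
    qed
    finally show "0 < (\<Sum>i\<in>S. \<Sum>j\<in>S. x i * (of_int (M i i) * of_int (A i j)) * x j)" .
  qed
qed

end

section \<open>The rational expression\<close>

lemma cartan_matrix_subset: "cartan_matrix S A \<Longrightarrow> I \<subseteq> S \<Longrightarrow> cartan_matrix I A"
  unfolding cartan_matrix_def by (auto intro: finite_subset) (use subsetD in metis)+

lemma finite_weyl_group_iff_finite_type:
  assumes "cartan_matrix S A"
  shows "finite (carrier (weyl_group S A)) \<longleftrightarrow> finite_type S A"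
proof -
  interpret cartan S A by standard (rule assms)
  show ?thesis
    unfolding length_series_eq_poincare(2)[OF subset_refl]
    using finite_type_imp_finite_weyl_ops finite_weyl_ops_imp_finite_type by blast
qed

lemma poincare_poly_nonzero:
  assumes "finite (carrier (weyl_group S A))"
  shows "poincare_poly S A \<noteq> 0"
proof -
  have "carrier (weyl_group S A) \<noteq> {}"
    using monoid.one_closed[OF group.is_monoid[OF group_weyl_group], of S A] by (rule ex_in_conv[THEN iffD1, OF exI])
  moreover have "poly (poincare_poly S A) 1 = int (card (carrier (weyl_group S A)))"
    by (simp add: poincare_poly_def poly_sum poly_monom)
  ultimately show ?thesis using assms by auto
qed

text \<open>
  The identity \<open>\<Sum>\<^sub>I (-1)\<^sup>|\<^sup>I\<^sup>| N\<^sub>I = 0\<close> solved for its term \<open>N\<^sub>S = 1\<close>, after multiplication by \<open>L\<close>.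
\<close>

lemma infinite_poincare_recursion:
  fixes A :: "'i \<Rightarrow> 'i \<Rightarrow> int" and L :: "int fps"
  assumes cm: "cartan_matrix S A" and inf: "infinite (carrier (weyl_group S A))"
    and Q: "\<And>I. I \<subset> S \<Longrightarrow> poincare_series I A * Q I = L"
  shows "poincare_series S A * ((-1) ^ Suc (card S) * (\<Sum>I\<in>Pow S - {S}. (-1) ^ card I * Q I)) = L"
proof -
  interpret cartan S A by standard (rule cm)
  define N where "N = (\<lambda>I. length_series (min_reps I))"
  define P where "P = (\<lambda>I. poincare_series I A)"
  have NP: "P S = N I * P I" if "I \<subseteq> S" for I
    using length_series_factor[OF that] length_series_eq_poincare(1)[OF that]
      length_series_eq_poincare(1)[OF subset_refl] by (simp add: N_def P_def)
  have "P S $ 0 \<noteq> 0"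
  proof -
    have "{f \<in> weyl_ops S. len f = 0} \<noteq> {}" using id_in_weyl_ops[of S] by auto
    then have "card {f \<in> weyl_ops S. len f = 0} \<noteq> 0" using finite_len[of 0] by simp
    then show ?thesis
      unfolding P_def length_series_eq_poincare(1)[OF subset_refl] length_series_def by simp
  qed
  then have "P S \<noteq> 0" by auto
  then have N_S: "N S = 1" using NP[of S] by simp
  have "0 = (\<Sum>I\<in>Pow S. (-1) ^ card I * N I) * L"
    using alternating_sum_min_reps inf length_series_eq_poincare(2)[OF subset_refl] by (simp add: N_def)
  also have "\<dots> = (\<Sum>I\<in>Pow S. (-1) ^ card I * (N I * L))"
    by (simp add: sum_distrib_right mult.assoc)
  also have "\<dots> = (-1) ^ card S * (N S * L) + (\<Sum>I\<in>Pow S - {S}. (-1) ^ card I * (N I * L))"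
    by (rule sum.remove) auto
  also have "(\<Sum>I\<in>Pow S - {S}. (-1) ^ card I * (N I * L)) = (\<Sum>I\<in>Pow S - {S}. P S * ((-1) ^ card I * Q I))"
  proof (intro sum.cong HOL.refl)
    fix I assume "I \<in> Pow S - {S}"
    then have I: "I \<subset> S" by auto
    have "N I * L = (N I * P I) * Q I" using Q[OF I] by (simp add: P_def mult.assoc)
    also have "\<dots> = P S * Q I" using NP[of I] I by auto
    finally show "(-1) ^ card I * (N I * L) = P S * ((-1) ^ card I * Q I)" by (simp add: mult_ac)
  qed
  finally have "(-1) ^ card S * L = - (P S * (\<Sum>I\<in>Pow S - {S}. (-1) ^ card I * Q I))"
    by (simp add: N_S sum_distrib_left eq_neg_iff_add_eq_0)
  then have "(-1) ^ card S * ((-1) ^ card S * L) =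
      (-1) ^ card S * - (P S * (\<Sum>I\<in>Pow S - {S}. (-1) ^ card I * Q I))" by simp
  moreover have "(-1) ^ card S * ((-1) ^ card S * L) = L"
    by (simp flip: mult.assoc power_mult_distrib)
  ultimately show ?thesis by (simp add: P_def mult_ac)
qed

text \<open>
  The polynomial \<open>L\<close> is kept fixed in the induction: any common multiple for \<open>S\<close> is one for each of its subsets.
\<close>

theorem poincare_series_rational:
  fixes L :: "int poly"
  assumes "cartan_matrix S A"
    and dvd: "\<And>I. I \<subseteq> S \<Longrightarrow> finite_type I A \<Longrightarrow> poincare_poly I A dvd L"
  shows "\<exists>Q. poincare_series S A * fps_of_poly Q = fps_of_poly L"
proof -
  have "finite S" using assms by (simp add: cartan_matrix_def)
  then show ?thesis using assms
  proof (induction S rule: finite_psubset_induct)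
    case (psubset S)
    show ?case
    proof (cases "finite (carrier (weyl_group S A))")
      case True
      then have "poincare_poly S A dvd L"
        using psubset.prems finite_weyl_group_iff_finite_type by blast
      then obtain Q where "L = poincare_poly S A * Q" by (elim dvdE)
      then show ?thesis
        using fps_of_poly_poincare_poly[OF True] by (auto simp: fps_of_poly_mult)
    next
      case False
      have "\<exists>Q. poincare_series I A * fps_of_poly Q = fps_of_poly L" if I: "I \<subset> S" for I
      proof (rule psubset.IH[OF I])
        show "cartan_matrix I A" using cartan_matrix_subset psubset.prems(1) I by blast
      qed (use psubset.prems(2) I in auto)
      then obtain Q where "\<And>I. I \<subset> S \<Longrightarrow> poincare_series I A * fps_of_poly (Q I) = fps_of_poly L"
        by metis
      from infinite_poincare_recursion[OF psubset.prems(1) False this]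
      have "poincare_series S A *
          fps_of_poly ((-1) ^ Suc (card S) * (\<Sum>I\<in>Pow S - {S}. (-1) ^ card I * Q I)) = fps_of_poly L"
        by (simp add: fps_of_poly_mult fps_of_poly_power fps_of_poly_sum fps_of_poly_uminus)
      then show ?thesis by blast
    qed
  qed
qed

theorem theorem3:
  fixes n :: nat and A :: "nat \<Rightarrow> nat \<Rightarrow> int" and L :: "int poly"
  assumes "cartan_matrix {1..n} A"
    and "L = Lcm {poincare_poly I A | I. I \<subseteq> {1..n} \<and> finite_type I A}"
  shows "\<exists>Q :: int poly. Q \<noteq> 0 \<and>
           poincare_series {1..n} A * fps_of_poly Q = fps_of_poly L"
proof -
  let ?X = "{poincare_poly I A | I. I \<subseteq> {1..n} \<and> finite_type I A}"
  have "?X = (\<lambda>I. poincare_poly I A) ` {I. I \<subseteq> {1..n} \<and> finite_type I A}" by blast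
  then have "finite ?X" by simp
  moreover have "0 \<notin> ?X"
  proof
    assume "0 \<in> ?X"
    then obtain I where I: "I \<subseteq> {1..n}" "finite_type I A" "poincare_poly I A = 0" by auto
    then have "finite (carrier (weyl_group I A))"
      using finite_weyl_group_iff_finite_type[OF cartan_matrix_subset[OF assms(1)]] by simp
    then show False using poincare_poly_nonzero I(3) by blast
  qed
  ultimately have "L \<noteq> 0" unfolding assms(2) by (simp add: Lcm_0_iff)
  have "poincare_poly I A dvd L" if "I \<subseteq> {1..n}" "finite_type I A" for I
    unfolding assms(2) using that by (intro dvd_Lcm) blast
  then obtain Q where Q: "poincare_series {1..n} A * fps_of_poly Q = fps_of_poly L"
    using poincare_series_rational[OF assms(1)] by blast
  with \<open>L \<noteq> 0\<close> have "Q \<noteq> 0" by auto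
  with Q show ?thesis by blast
qed

end
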